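(* Let $\mathcal{P}_{\mathrm{full}}$ be a full plant behavior and let $\mathcal{S}$ be a specification. The class $\mathfrak{C}_{\mathrm{can}}^{\mathrm{reg}}$ of regular controllers that are equivalent to the canonical controller is nonempty if and only if the specification $\mathcal{S}$ is regularly implementable.
   Context: A (linear differential) behavior in $q$ variables is a set of the form $\{x\in\mathfrak{C}^\infty(\mathbb{R},\mathbb{R}^q) : A(\frac{d}{dt})x=0\}$ with $A\in\mathbb{R}^{g\times q}[\xi]$ a real polynomial matrix ($g\ge 0$); $A$ (or $A(\frac{d}{dt})$) is called a kernel representation. Here $\mathfrak{C}^\infty$ denotes infinitely differentiable functions. Ranks of polynomial matrices are taken over the field $\mathbb{R}(\xi)$. Every behavior has a kernel representation of full row rank. Full plant behavior: $\mathcal{P}_{\mathrm{full}}=\{(w,c)\in\mathfrak{C}^{\infty}(\mathbb{R},\mathbb{R}^{\mathtt{w}+\mathtt{c}}) : R(\frac{d}{dt})w+M(\frac{d}{dt})c=0\}$, with $R,M$ real polynomial matrices; $w$ are the to-be-controlled variables and $c$ the control variables, of dimensions $\mathtt{w}$ and $\mathtt{c}$. A specification is a behavior $\mathcal{S}=\{w\in\mathfrak{C}^{\infty}(\mathbb{R},\mathbb{R}^{\mathtt{w}}) : S(\frac{d}{dt})w=0\}$, $S$ a real polynomial matrix. A controller is a behavior $\mathcal{C}=\{c\in\mathfrak{C}^{\infty}(\mathbb{R},\mathbb{R}^{\mathtt{c}}) : C(\frac{d}{dt})c=0\}$, $C$ a real polynomial matrix. A controller $\mathcal{C}$ implements $\mathcal{S}$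 if the controlled behavior $\{w\in\mathfrak{C}^{\infty}(\mathbb{R},\mathbb{R}^{\mathtt{w}}) : \exists\, c\in\mathcal{C} \text{ with } (w,c)\in\mathcal{P}_{\mathrm{full}}\}$ equals $\mathcal{S}$. A controller $\mathcal{C}$, given by a full row rank $C$, is regular if $\operatorname{rank}\begin{bmatrix}R&M\\0&C\end{bmatrix}=\operatorname{rank}\begin{bmatrix}R&M\end{bmatrix}+\operatorname{rank}C$ (this does not depend on the chosen representations). $\mathcal{S}$ is regularly implementable if some regular controller implements it. Control manifest behavior: $\mathcal{P}_c=\{c\in\mathfrak{C}^{\infty}(\mathbb{R},\mathbb{R}^{\mathtt{c}}) : \exists\, w\in\mathfrak{C}^{\infty}(\mathbb{R},\mathbb{R}^{\mathtt{w}}),\ (w,c)\in\mathcal{P}_{\mathrm{full}}\}$. Canonical controller: $\mathcal{C}_{\mathrm{can}}=\{c\in\mathfrak{C}^{\infty}(\mathbb{R},\mathbb{R}^{\mathtt{c}}) : \exists\, w\in\mathcal{S},\ (w,c)\in\mathcal{P}_{\mathrm{full}}\}$. Both $\mathcal{P}_c$ and $\mathcal{C}_{\mathrm{can}}$ are linear differential behaviors in $\mathtt{c}$ variables; kernel representations are obtained by eliminating $w$. Finally $\mathfrak{C}_{\mathrm{can}}^{\mathrm{reg}}=\{\mathcal{C} : \mathcal{C}\text{ is a regular controller and }\mathcal{C}\cap\mathcal{P}_c=\mathcal{C}_{\mathrm{can}}\cap\mathcal{P}_c\}$.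
   Formalization: The specification S is additionally assumed to be implementable by some (not necessarily regular) controller; without this the claim fails, e.g. for the plant w = 0 with c free and the specification in which w is free. *)

theory Defs
  imports
    "HOL-Analysis.Derivative"
    "HOL-Computational_Algebra.Polynomial_Factorial"
    "Jordan_Normal_Form.DL_Rank"
begin

no_notation vec_nth (infixl \<open>$\<close> 90)

text \<open>
  Trajectories with values in \<open>\<real>\<^sup>q\<close> are functions into \<^typ>\<open>real vec\<close>
  with values in \<^term>\<open>carrier_vec q\<close>, so that all dimensions are ordinary natural numbers.
  Smoothness and differentiation are componentwise.
\<close>

definition smooth :: "(real \<Rightarrow> real) \<Rightarrow> bool" where
  "smooth f \<longleftrightarrow> (\<forall>k t. (deriv ^^ k) f differentiable (at t))"

definition smooth_traj :: "nat \<Rightarrow> (real \<Rightarrow> real vec) set" where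
  "smooth_traj q = {x. (\<forall>t. x t \<in> carrier_vec q) \<and> (\<forall>j<q. smooth (\<lambda>t. x t $ j))}"

definition poly_diff :: "real poly \<Rightarrow> (real \<Rightarrow> real) \<Rightarrow> real \<Rightarrow> real" where
  "poly_diff p f t = (\<Sum>k\<le>degree p. coeff p k * (deriv ^^ k) f t)"

definition mat_diff :: "real poly mat \<Rightarrow> (real \<Rightarrow> real vec) \<Rightarrow> real \<Rightarrow> real vec" where
  "mat_diff A x t =
     vec (dim_row A) (\<lambda>i. \<Sum>j<dim_col A. poly_diff (A $$ (i, j)) (\<lambda>s. x s $ j) t)"

text \<open>The number of rows of \<open>A\<close> may be zero, in which case the behavior is everything.\<close>

definition behavior :: "real poly mat \<Rightarrow> (real \<Rightarrow> real vec) set" where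
  "behavior A = {x \<in> smooth_traj (dim_col A). \<forall>t. mat_diff A x t = 0\<^sub>v (dim_row A)}"

definition full_plant ::
    "real poly mat \<Rightarrow> real poly mat \<Rightarrow> ((real \<Rightarrow> real vec) \<times> (real \<Rightarrow> real vec)) set" where
  "full_plant R M =
     {(w, c). w \<in> smooth_traj (dim_col R) \<and> c \<in> smooth_traj (dim_col M) \<and>
       (\<forall>t. mat_diff R w t + mat_diff M c t = 0\<^sub>v (dim_row R))}"

text \<open>Rank over the field of rational functions.\<close>

definition prank :: "real poly mat \<Rightarrow> nat" where
  "prank A = vec_space.rank (dim_row A) (map_mat to_fract A)"

text \<open>
  From here on a full plant is given by polynomial matrices \<open>R\<close> and \<open>M\<close> with equally many rows,
  and specifications and controllers are sets of trajectories.
\<close>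

definition controller :: "real poly mat \<Rightarrow> (real \<Rightarrow> real vec) set \<Rightarrow> bool" where
  "controller M K \<longleftrightarrow> (\<exists>C. dim_col C = dim_col M \<and> K = behavior C)"

definition controlled_behavior ::
    "real poly mat \<Rightarrow> real poly mat \<Rightarrow> (real \<Rightarrow> real vec) set \<Rightarrow> (real \<Rightarrow> real vec) set" where
  "controlled_behavior R M K =
     {w \<in> smooth_traj (dim_col R). \<exists>c\<in>K. (w, c) \<in> full_plant R M}"

definition implements ::
    "real poly mat \<Rightarrow> real poly mat \<Rightarrow> (real \<Rightarrow> real vec) set \<Rightarrow> (real \<Rightarrow> real vec) set \<Rightarrow> bool" where
  "implements R M K S \<longleftrightarrow> controlled_behavior R M K = S"

text \<open>
  Every behavior has a kernel representation of full row rank, and the rank condition is the same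
  for all of them; so asking for one such representation is enough.
\<close>

definition regular_controller ::
    "real poly mat \<Rightarrow> real poly mat \<Rightarrow> (real \<Rightarrow> real vec) set \<Rightarrow> bool" where
  "regular_controller R M K \<longleftrightarrow>
     (\<exists>C. dim_col C = dim_col M \<and> prank C = dim_row C \<and> K = behavior C \<and>
        prank (four_block_mat R M (0\<^sub>m (dim_row C) (dim_col R)) C) =
        prank (four_block_mat R M (0\<^sub>m 0 (dim_col R)) (0\<^sub>m 0 (dim_col M))) + prank C)"

text \<open>
  Implementability has to be assumed when regular implementability is compared with the existence
  of regular controllers \<open>K\<close> such that \<open>K \<inter> \<P>\<^sub>c = \<C>\<^sub>c\<^sub>a\<^sub>n \<inter> \<P>\<^sub>c\<close>: for the plant \<open>w = 0\<close> with \<open>c\<close> free and the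
  specification in which \<open>w\<close> is free, the trivial controller is such a \<open>K\<close>, but the controlled
  behavior is \<open>{0}\<close> for every controller.
\<close>

definition implementable ::
    "real poly mat \<Rightarrow> real poly mat \<Rightarrow> (real \<Rightarrow> real vec) set \<Rightarrow> bool" where
  "implementable R M S \<longleftrightarrow> (\<exists>K. controller M K \<and> implements R M K S)"

definition regularly_implementable ::
    "real poly mat \<Rightarrow> real poly mat \<Rightarrow> (real \<Rightarrow> real vec) set \<Rightarrow> bool" where
  "regularly_implementable R M S \<longleftrightarrow>
     (\<exists>K. regular_controller R M K \<and> implements R M K S)"

definition control_manifest ::
    "real poly mat \<Rightarrow> real poly mat \<Rightarrow> (real \<Rightarrow> real vec) set" where
  "control_manifest R M =
     {c \<in> smooth_traj (dim_col M). \<exists>w\<in>smooth_traj (dim_col R). (w, c) \<in> full_plant R M}"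

definition canonical_controller ::
    "real poly mat \<Rightarrow> real poly mat \<Rightarrow> (real \<Rightarrow> real vec) set \<Rightarrow> (real \<Rightarrow> real vec) set" where
  "canonical_controller R M S =
     {c \<in> smooth_traj (dim_col M). \<exists>w\<in>S. (w, c) \<in> full_plant R M}"

definition regular_canonical_controllers ::
    "real poly mat \<Rightarrow> real poly mat \<Rightarrow> (real \<Rightarrow> real vec) set \<Rightarrow> (real \<Rightarrow> real vec) set set" where
  "regular_canonical_controllers R M S =
     {K. regular_controller R M K \<and>
         K \<inter> control_manifest R M = canonical_controller R M S \<inter> control_manifest R M}"

end

theory Submission
  imports
    Defs
    "HOL-Analysis.Interval_Integral"
    "HOL-Computational_Algebra.Fundamental_Theorem_Algebra"
    "HOL-Library.Function_Algebras"
    "Jordan_Normal_Form.Char_Poly"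
begin

text \<open>
  One direction is set theory. If \<open>K\<close> agrees with the canonical controller on \<open>\<P>\<^sub>c\<close>, then the behavior
  controlled by \<open>K\<close> consists of the \<open>w\<close> for which some \<open>c\<close> is compatible both with \<open>w\<close> and with some
  \<open>w' \<in> \<S>\<close>. Since \<open>\<S>\<close> is implementable, \<open>w'\<close> is also compatible with some \<open>c\<^sub>0\<close> of an implementing
  controller; by linearity \<open>c\<^sub>0\<close> is then compatible with \<open>w\<close> (\<open>full_plant_exchange\<close>), so \<open>w \<in> \<S>\<close>.

  For the other direction let the regular controller \<open>K = ker C\<close> implement \<open>\<S>\<close>. Linearity again shows
  that the canonical controller is \<open>(K + ker M) \<inter> \<P>\<^sub>c\<close>, so it suffices that \<open>K' = K + ker M\<close> is a regular
  controller. Two facts make this work.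

  \<^item> \<open>K'\<close> is the kernel of a polynomial matrix, and the rows of that matrix are combinations of the rows
    of \<open>C\<close> (\<open>kernel_representation_of_sum\<close>). Membership of \<open>c\<close> in \<open>K'\<close> means that the system
    \<open>C c' = 0\<close>, \<open>M c' = M c\<close> has a solution \<open>c'\<close>. Smooth functions form a divisible module over the
    principal ideal ring \<open>\<real>[\<xi>]\<close>, because every scalar equation \<open>p(d/dt) y = f\<close> with \<open>p \<noteq> 0\<close> has a
    smooth solution (\<open>poly_act_surj\<close>). Over such a module a linear system is solvable exactly when
    every row vector annihilating its matrix annihilates its right-hand side
    (\<open>solvable_iff_annihilators\<close>). So \<open>K'\<close> is cut out by the rows \<open>u C\<close> for which \<open>u C + v M = 0\<close> for
    some \<open>v\<close>. These rows form a submodule of a free module of finite rank, which has a finite basis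
    (\<open>submodule_has_row_basis\<close>), and a basis is a full row rank representation.

  \<^item> Regularity says that \<open>u R = 0\<close> and \<open>u M + v C = 0\<close> together force \<open>v = 0\<close> (\<open>regular_rank_iff\<close>). In
    this form it clearly passes from \<open>C\<close> to any matrix \<open>L C\<close> of full row rank.

  The criterion for the solvability of linear systems is used a second time to prove this description
  of regularity: \<open>\<real>(\<xi>)\<close> is also a divisible module over \<open>\<real>[\<xi>]\<close>, and applied to it the criterion
  compares the column space of a polynomial matrix with its polynomial left annihilators.
\<close>

section \<open>Linear systems over Euclidean rings with right-hand sides in divisible modules\<close>

text \<open>
  Euclidean rings are principal ideal rings: an element of minimal Euclidean size generates the ideal,
  since the remainder of any other element by it lies in the ideal and is smaller.
\<close>

lemma ideal_has_dividing_element: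
  fixes I :: "'r :: euclidean_ring set"
  assumes "I \<noteq> {}" and add: "\<And>a b. a \<in> I \<Longrightarrow> b \<in> I \<Longrightarrow> a + b \<in> I"
    and mult: "\<And>c a. a \<in> I \<Longrightarrow> c * a \<in> I"
  shows "\<exists>d\<in>I. \<forall>a\<in>I. d dvd a"
proof (cases "\<exists>a\<in>I. a \<noteq> 0")
  case False
  with assms(1) show ?thesis by auto
next
  case True
  then obtain d where d: "d \<in> I" "d \<noteq> 0"
    and min: "\<And>b. b \<in> I \<Longrightarrow> b \<noteq> 0 \<Longrightarrow> euclidean_size d \<le> euclidean_size b"
    using exists_least_iff[of "\<lambda>n. \<exists>a\<in>I. a \<noteq> 0 \<and> euclidean_size a = n"]
    by (metis not_le)
  have "d dvd a" if "a \<in> I" for a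
  proof -
    have "a mod d = a + (- (a div d)) * d"
      by (simp add: minus_div_mult_eq_mod[symmetric])
    then have "a mod d \<in> I"
      using add[OF that mult[OF d(1)], of "- (a div d)"] by metis
    with min[of "a mod d"] mod_size_less[OF d(2), of a] have "a mod d = 0"
      by force
    then show ?thesis by (simp add: dvd_eq_mod_eq_0)
  qed
  with d(1) show ?thesis by blast
qed

text \<open>
  Row vectors are represented as functions on \<open>nat\<close>, so that the number of columns is not part of
  the type and one can do induction on it.
\<close>

definition row_basis :: "(nat \<Rightarrow> 'r :: euclidean_ring) set \<Rightarrow> nat \<Rightarrow> (nat \<Rightarrow> nat \<Rightarrow> 'r) \<Rightarrow> bool" where
  "row_basis N k B \<longleftrightarrow> (\<forall>i<k. B i \<in> N) \<and>
     (\<forall>x\<in>N. \<exists>u. \<forall>j. x j = (\<Sum>i<k. u i * B i j)) \<and>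
     (\<forall>u. (\<forall>j. (\<Sum>i<k. u i * B i j) = 0) \<longrightarrow> (\<forall>i<k. u i = 0))"

lemma
  assumes "row_basis N k B"
  shows row_basis_in: "i < k \<Longrightarrow> B i \<in> N"
    and row_basis_generates: "x \<in> N \<Longrightarrow> \<exists>u. \<forall>j. x j = (\<Sum>i<k. u i * B i j)"
    and row_basis_independent: "(\<And>j. (\<Sum>i<k. u i * B i j) = 0) \<Longrightarrow> i < k \<Longrightarrow> u i = 0"
proof -
  note basis = assms[unfolded row_basis_def]
  show "i < k \<Longrightarrow> B i \<in> N" using basis[THEN conjunct1] by blast
  show "x \<in> N \<Longrightarrow> \<exists>u. \<forall>j. x j = (\<Sum>i<k. u i * B i j)"
    by (rule basis[THEN conjunct2, THEN conjunct1, THEN bspec])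
  show "u i = 0" if "\<And>j. (\<Sum>i<k. u i * B i j) = 0" "i < k"
    by (rule basis[THEN conjunct2, THEN conjunct2, THEN spec, of u, THEN mp, THEN spec, THEN mp])
      (use that in simp_all)
qed

text \<open>
  Submodules of free modules over a principal ideal ring are free. The basis is built in echelon form:
  the elements whose last coordinate vanishes have a basis by induction, and at most one further
  element is needed, whose last coordinate generates the ideal of all last coordinates.
\<close>

lemma submodule_has_row_basis:
  fixes N :: "(nat \<Rightarrow> 'r :: euclidean_ring) set"
  assumes "N \<noteq> {}"
    and "\<And>x y. x \<in> N \<Longrightarrow> y \<in> N \<Longrightarrow> (\<lambda>j. x j + y j) \<in> N"
    and "\<And>c x. x \<in> N \<Longrightarrow> (\<lambda>j. c * x j) \<in> N"
    and "\<And>x j. x \<in> N \<Longrightarrow> j \<ge> n \<Longrightarrow> x j = 0"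
  shows "\<exists>k B. row_basis N k B"
  using assms
proof (induction n arbitrary: N)
  case 0
  then have "row_basis N 0 (\<lambda>_ _. 0)" by (simp add: row_basis_def)
  then show ?case by blast
next
  case (Suc n)
  let ?N = "{x \<in> N. x n = 0}"
  obtain x0 where "x0 \<in> N" using Suc.prems(1) by blast
  have "(\<lambda>j. 0) \<in> N" using Suc.prems(3)[OF \<open>x0 \<in> N\<close>, of 0] by simp
  then have "?N \<noteq> {}" by auto
  moreover have "(\<lambda>j. x j + y j) \<in> ?N" if "x \<in> ?N" "y \<in> ?N" for x y
    using that Suc.prems(2) by auto
  moreover have "(\<lambda>j. c * x j) \<in> ?N" if "x \<in> ?N" for c x
    using that Suc.prems(3) by auto
  moreover have "x j = 0" if "x \<in> ?N" "j \<ge> n" for x j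
    using that Suc.prems(4)[of x j] by (cases "j = n") auto
  ultimately have "\<exists>k B. row_basis ?N k B" by (rule Suc.IH)
  then obtain k B where kB: "row_basis ?N k B" by (elim exE)
  then have BN: "\<forall>i<k. B i \<in> ?N"
    and gen: "\<forall>x\<in>?N. \<exists>u. \<forall>j. x j = (\<Sum>i<k. u i * B i j)"
    and indep: "\<forall>u. (\<forall>j. (\<Sum>i<k. u i * B i j) = 0) \<longrightarrow> (\<forall>i<k. u i = 0)"
    unfolding row_basis_def by blast+
  have add_I: "a + b \<in> (\<lambda>x. x n) ` N" if "a \<in> (\<lambda>x. x n) ` N" "b \<in> (\<lambda>x. x n) ` N" for a b
  proof -
    from that obtain x y where "x \<in> N" "y \<in> N" "a = x n" "b = y n" by blast
    then show ?thesis using Suc.prems(2)[of x y] by (intro image_eqI[of _ _ "\<lambda>j. x j + y j"]) auto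
  qed
  have mult_I: "c * a \<in> (\<lambda>x. x n) ` N" if "a \<in> (\<lambda>x. x n) ` N" for c a
  proof -
    from that obtain x where "x \<in> N" "a = x n" by blast
    then show ?thesis using Suc.prems(3)[of x c] by (intro image_eqI[of _ _ "\<lambda>j. c * x j"]) auto
  qed
  have "\<exists>d\<in>(\<lambda>x. x n) ` N. \<forall>a\<in>(\<lambda>x. x n) ` N. d dvd a"
    using Suc.prems(1) add_I mult_I by (intro ideal_has_dividing_element) auto
  then obtain b d where b: "b \<in> N" "b n = d" and dvd: "\<And>x. x \<in> N \<Longrightarrow> d dvd x n"
    by blast
  show ?case
  proof (cases "d = 0")
    case True
    then have "?N = N" using dvd by auto
    with kB show ?thesis by auto
  next
    case False
    let ?B = "B(k := b)"
    have [simp]: "(\<Sum>i<Suc k. u i * ?B i j) = (\<Sum>i<k. u i * B i j) + u k * b j" for u j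
      by (simp add: sum.lessThan_Suc)
    have in_N: "\<forall>i<Suc k. ?B i \<in> N" using BN b(1) by (auto simp: less_Suc_eq)
    have generates: "\<forall>x\<in>N. \<exists>u. \<forall>j. x j = (\<Sum>i<Suc k. u i * ?B i j)"
    proof
      fix x assume "x \<in> N"
      obtain q where q: "x n = d * q" using dvd[OF \<open>x \<in> N\<close>] by (rule dvdE)
      have "(\<lambda>j. x j + (- q) * b j) \<in> N"
        using Suc.prems(2)[OF \<open>x \<in> N\<close> Suc.prems(3)[OF b(1), of "- q"]] by simp
      then have "(\<lambda>j. x j + (- q) * b j) \<in> ?N" using q b(2) by (simp add: mult.commute)
      from gen[rule_format, OF this]
      obtain u where u: "\<And>j. x j + (- q) * b j = (\<Sum>i<k. u i * B i j)" by blast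
      have s: "(\<Sum>i<k. (u(k := q)) i * B i j) = (\<Sum>i<k. u i * B i j)" for j
        by (intro sum.cong) auto
      have "x j = (\<Sum>i<Suc k. (u(k := q)) i * ?B i j)" for j
        using u[of j] s[of j] by (simp add: algebra_simps)
      then show "\<exists>u. \<forall>j. x j = (\<Sum>i<Suc k. u i * ?B i j)" by blast
    qed
    have independent: "\<forall>u. (\<forall>j. (\<Sum>i<Suc k. u i * ?B i j) = 0) \<longrightarrow> (\<forall>i<Suc k. u i = 0)"
    proof (intro allI impI)
      fix u i assume u: "\<forall>j. (\<Sum>i<Suc k. u i * ?B i j) = 0" and "i < Suc k"
      have "(\<Sum>i<k. u i * B i n) = 0" using BN by (intro sum.neutral) auto
      with u[rule_format, of n] b(2) False have "u k = 0" by simp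
      with u have "\<forall>j. (\<Sum>i<k. u i * B i j) = 0" by simp
      from indep[THEN spec, THEN mp, OF this] \<open>u k = 0\<close> \<open>i < Suc k\<close> show "u i = 0" by (auto simp: less_Suc_eq)
    qed
    have "row_basis N (Suc k) ?B"
      unfolding row_basis_def by (intro conjI in_N generates independent)
    then show ?thesis by blast
  qed
qed

locale divisible_module = Modules.module scale
  for scale :: "'r :: euclidean_ring \<Rightarrow> 'm :: ab_group_add \<Rightarrow> 'm" (infixr \<open>\<star>\<close> 75) +
  assumes divisible: "p \<noteq> 0 \<Longrightarrow> \<exists>x. p \<star> x = y"
begin

text \<open>
  This is the injectivity of divisible modules over principal ideal rings, for finite systems; for
  ordinary differential equations it is the one-variable case of the Ehrenpreis fundamental principle.
  The nontrivial direction eliminates the last unknown. Combinations of the equations that no longer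
  contain the other unknowns have the form \<open>a z = f\<close> for the last unknown \<open>z\<close>, and the coefficients
  \<open>a\<close> form an ideal. Solving the equation whose coefficient generates the ideal solves all of them,
  and what remains is a solvable system in fewer unknowns.
\<close>

theorem solvable_iff_annihilators:
  fixes A :: "'i \<Rightarrow> nat \<Rightarrow> 'r" and y :: "'i \<Rightarrow> 'm"
  assumes "finite I"
  shows "(\<exists>x. \<forall>i\<in>I. (\<Sum>j<n. A i j \<star> x j) = y i) \<longleftrightarrow>
    (\<forall>u. (\<forall>j<n. (\<Sum>i\<in>I. u i * A i j) = 0) \<longrightarrow> (\<Sum>i\<in>I. u i \<star> y i) = 0)"
proof
  assume "\<exists>x. \<forall>i\<in>I. (\<Sum>j<n. A i j \<star> x j) = y i"
  then obtain x where x: "\<And>i. i \<in> I \<Longrightarrow> y i = (\<Sum>j<n. A i j \<star> x j)" by metis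
  show "\<forall>u. (\<forall>j<n. (\<Sum>i\<in>I. u i * A i j) = 0) \<longrightarrow> (\<Sum>i\<in>I. u i \<star> y i) = 0"
  proof (intro allI impI)
    fix u assume u: "\<forall>j<n. (\<Sum>i\<in>I. u i * A i j) = 0"
    have "(\<Sum>i\<in>I. u i \<star> y i) = (\<Sum>i\<in>I. \<Sum>j<n. (u i * A i j) \<star> x j)"
      by (simp add: x scale_sum_right)
    also have "\<dots> = (\<Sum>j<n. (\<Sum>i\<in>I. u i * A i j) \<star> x j)"
      by (subst sum.swap) (simp add: scale_sum_left)
    finally show "(\<Sum>i\<in>I. u i \<star> y i) = 0" using u by simp
  qed
next
  assume "\<forall>u. (\<forall>j<n. (\<Sum>i\<in>I. u i * A i j) = 0) \<longrightarrow> (\<Sum>i\<in>I. u i \<star> y i) = 0"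
  then show "\<exists>x. \<forall>i\<in>I. (\<Sum>j<n. A i j \<star> x j) = y i"
  proof (induction n arbitrary: y)
    case 0
    have "y k = 0" if "k \<in> I" for k
    proof -
      have "(\<Sum>i\<in>I. (if i = k then 1 else 0) \<star> y i) = (\<Sum>i\<in>I. if i = k then y i else 0)"
        by (intro sum.cong) auto
      with 0[rule_format, of "\<lambda>i. if i = k then 1 else 0"] that assms show ?thesis
        by (simp add: sum.delta)
    qed
    then show ?case by simp
  next
    case (Suc n)
    \<comment> \<open>The combinations of the equations in which only the last unknown is left, and its coefficient there.\<close>
    define ann where "ann = {u. \<forall>j<n. (\<Sum>i\<in>I. u i * A i j) = 0}"
    define last where "last u = (\<Sum>i\<in>I. u i * A i n)" for u
    have "(\<lambda>i. 0) \<in> ann" by (simp add: ann_def)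
    then have nonempty: "last ` ann \<noteq> {}" by blast
    have add_J: "a + b \<in> last ` ann" if "a \<in> last ` ann" "b \<in> last ` ann" for a b
    proof -
      from that obtain u v where uv: "u \<in> ann" "v \<in> ann" and ab: "a = last u" "b = last v"
        by blast
      have "a + b = last (\<lambda>i. u i + v i)" "(\<lambda>i. u i + v i) \<in> ann"
        using uv by (simp_all add: ab last_def ann_def distrib_right sum.distrib)
      then show ?thesis by blast
    qed
    have mult_J: "c * a \<in> last ` ann" if "a \<in> last ` ann" for c a
    proof -
      from that obtain u where u: "u \<in> ann" and a: "a = last u" by blast
      have "c * a = last (\<lambda>i. c * u i)" "(\<lambda>i. c * u i) \<in> ann"
        using u by (simp_all add: a last_def ann_def mult.assoc sum_distrib_left[symmetric])
      then show ?thesis by blast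
    qed
    from ideal_has_dividing_element[OF nonempty add_J mult_J]
    obtain w where w: "w \<in> ann" and dvd: "\<And>u. u \<in> ann \<Longrightarrow> last w dvd last u"
      by blast
    \<comment> \<open>If the generator is zero, the equation for the last unknown is solvable only because the
      combination annihilates the whole system.\<close>
    obtain z where z: "last w \<star> z = (\<Sum>i\<in>I. w i \<star> y i)"
    proof (cases "last w = 0")
      case True
      then have "\<forall>j<Suc n. (\<Sum>i\<in>I. w i * A i j) = 0"
        using w by (auto simp: less_Suc_eq ann_def last_def)
      with Suc.prems have "(\<Sum>i\<in>I. w i \<star> y i) = 0" by blast
      with True that[of 0] show ?thesis by simp
    next
      case False
      with divisible[of "last w" "\<Sum>i\<in>I. w i \<star> y i"] that show ?thesis by blast
    qed
    have "(\<Sum>i\<in>I. u i \<star> (y i - A i n \<star> z)) = 0" if u: "u \<in> ann" for u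
    proof -
      obtain q where q: "last u = last w * q" using dvd[OF u] by (rule dvdE)
      \<comment> \<open>Subtracting the multiple of the generating combination removes the last unknown from \<open>u\<close>.\<close>
      have split: "(\<Sum>i\<in>I. (u i - q * w i) * A i j) = (\<Sum>i\<in>I. u i * A i j) - q * (\<Sum>i\<in>I. w i * A i j)" for j
        by (simp add: left_diff_distrib sum_subtractf mult.assoc sum_distrib_left)
      have "\<forall>j<Suc n. (\<Sum>i\<in>I. (u i - q * w i) * A i j) = 0"
        using u w q unfolding split by (auto simp: less_Suc_eq ann_def last_def mult.commute)
      then have "(\<Sum>i\<in>I. (u i - q * w i) \<star> y i) = 0"
        using Suc.prems[rule_format, of "\<lambda>i. u i - q * w i"] by simp
      then have "(\<Sum>i\<in>I. u i \<star> y i) = q \<star> (\<Sum>i\<in>I. w i \<star> y i)"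
        by (simp add: scale_left_diff_distrib sum_subtractf scale_sum_right)
      also have "\<dots> = last u \<star> z" by (simp add: z[symmetric] q mult.commute)
      also have "\<dots> = (\<Sum>i\<in>I. u i \<star> A i n \<star> z)" by (simp add: last_def scale_sum_left)
      finally show ?thesis by (simp add: scale_right_diff_distrib sum_subtractf)
    qed
    then obtain x where x: "\<forall>i\<in>I. (\<Sum>j<n. A i j \<star> x j) = y i - A i n \<star> z"
      using Suc.IH[of "\<lambda>i. y i - A i n \<star> z"] unfolding ann_def by blast
    have "(\<Sum>j<n. A i j \<star> (x(n := z)) j) = (\<Sum>j<n. A i j \<star> x j)" for i
      by (intro sum.cong) auto
    with x have "\<forall>i\<in>I. (\<Sum>j<Suc n. A i j \<star> (x(n := z)) j) = y i" by simp
    then show ?case by blast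
  qed
qed

end

section \<open>Smooth functions as a divisible module over the real polynomials\<close>

text \<open>
  Smoothness by coinduction: it is enough to find a set of functions that is closed under taking
  derivatives. Solutions of differential equations are smooth for this reason, as the equation
  expresses their derivatives again through the solutions and the smooth forcing terms.
\<close>

lemma smooth_coinduct:
  assumes "f \<in> X"
    and deriv_in: "\<And>g. g \<in> X \<Longrightarrow> \<exists>g'\<in>X. \<forall>t. (g has_real_derivative g' t) (at t)"
  shows "smooth f"
proof -
  have deriv_X: "deriv g \<in> X \<and> (\<forall>t. g differentiable (at t))" if "g \<in> X" for g
  proof -
    obtain g' where g': "g' \<in> X" "\<And>t. (g has_real_derivative g' t) (at t)"
      using deriv_in[OF \<open>g \<in> X\<close>] by blast
    then have "deriv g = g'" by (auto intro!: ext DERIV_imp_deriv)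
    with g' show ?thesis by (auto simp: real_differentiable_def)
  qed
  have "(deriv ^^ k) f \<in> X" for k
    by (induction k) (auto simp: assms(1) deriv_X)
  then show ?thesis unfolding smooth_def using deriv_X by blast
qed

lemma smooth_deriv: "smooth f \<Longrightarrow> smooth (deriv f)"
  unfolding smooth_def by (metis funpow_Suc_right comp_apply)

lemma smooth_DERIV: "smooth f \<Longrightarrow> (f has_real_derivative deriv f t) (at t)"
  unfolding smooth_def by (metis DERIV_deriv_iff_real_differentiable funpow_0)

lemma smooth_lincomb:
  assumes "smooth f" "smooth g"
  shows "smooth (\<lambda>t. a * f t + b * g t)"
proof (rule smooth_coinduct)
  show "(\<lambda>t. a * f t + b * g t) \<in> {(\<lambda>t. a * f t + b * g t) | f g. smooth f \<and> smooth g}"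
    using assms by blast
next
  fix h assume "h \<in> {(\<lambda>t. a * f t + b * g t) | f g. smooth f \<and> smooth g}"
  then obtain f g where h: "h = (\<lambda>t. a * f t + b * g t)" "smooth f" "smooth g" by blast
  show "\<exists>h'\<in>{(\<lambda>t. a * f t + b * g t) | f g. smooth f \<and> smooth g}. \<forall>t. (h has_real_derivative h' t) (at t)"
    by (rule bexI[of _ "\<lambda>t. a * deriv f t + b * deriv g t"])
      (use h in \<open>auto intro!: derivative_eq_intros smooth_DERIV smooth_deriv\<close>)
qed

lemma smooth_zero: "smooth (\<lambda>t. 0)"
  by (rule smooth_coinduct[of _ "{\<lambda>t. 0}"]) (auto intro: derivative_eq_intros)

text \<open>
  As a type, the smooth functions are an abelian group, so that they can serve as the module
  in the solvability criterion above.
\<close>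

typedef smooth_fun = "{f. smooth f}"
  using smooth_zero by blast

setup_lifting type_definition_smooth_fun

instantiation smooth_fun :: real_vector
begin

lift_definition zero_smooth_fun :: smooth_fun is "\<lambda>t. 0"
  by (rule smooth_zero)

lift_definition plus_smooth_fun :: "smooth_fun \<Rightarrow> smooth_fun \<Rightarrow> smooth_fun" is "\<lambda>f g t. f t + g t"
  using smooth_lincomb[of _ _ 1 1] by simp

lift_definition minus_smooth_fun :: "smooth_fun \<Rightarrow> smooth_fun \<Rightarrow> smooth_fun" is "\<lambda>f g t. f t - g t"
  using smooth_lincomb[of _ _ 1 "-1"] by simp

lift_definition uminus_smooth_fun :: "smooth_fun \<Rightarrow> smooth_fun" is "\<lambda>f t. - f t"
  using smooth_lincomb[of _ _ "-1" 0] by fastforce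

lift_definition scaleR_smooth_fun :: "real \<Rightarrow> smooth_fun \<Rightarrow> smooth_fun" is "\<lambda>a f t. a * f t"
  using smooth_lincomb[of _ _ _ 0] by fastforce

instance
  by standard (transfer; simp add: fun_eq_iff algebra_simps)+

end

lift_definition diff_op :: "smooth_fun \<Rightarrow> smooth_fun" is deriv
  by (rule smooth_deriv)

lemma linear_diff_op: "linear diff_op"
proof (rule linearI)
  show "diff_op (f + g) = diff_op f + diff_op g" for f g
    by transfer (auto intro!: ext DERIV_imp_deriv derivative_eq_intros smooth_DERIV)
  show "diff_op (a *\<^sub>R f) = a *\<^sub>R diff_op f" for a f
    by transfer (auto intro!: ext DERIV_imp_deriv derivative_eq_intros smooth_DERIV)
qed

definition poly_act :: "real poly \<Rightarrow> smooth_fun \<Rightarrow> smooth_fun" (infixr \<open>\<star>\<close> 75) where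
  "p \<star> f = (\<Sum>k\<le>degree p. coeff p k *\<^sub>R (diff_op ^^ k) f)"

lemma Rep_sum: "Rep_smooth_fun (\<Sum>i\<in>I. f i) t = (\<Sum>i\<in>I. Rep_smooth_fun (f i) t)"
  by (induction I rule: infinite_finite_induct) (simp_all add: zero_smooth_fun.rep_eq plus_smooth_fun.rep_eq)

lemma Rep_poly_act: "Rep_smooth_fun (p \<star> f) = poly_diff p (Rep_smooth_fun f)"
proof -
  have "Rep_smooth_fun ((diff_op ^^ k) f) = (deriv ^^ k) (Rep_smooth_fun f)" for k
    by (induction k) (simp_all add: diff_op.rep_eq)
  then show ?thesis
    by (simp add: fun_eq_iff poly_act_def poly_diff_def Rep_sum scaleR_smooth_fun.rep_eq)
qed

lemma poly_act_upto:
  "degree p \<le> n \<Longrightarrow> p \<star> f = (\<Sum>k\<le>n. coeff p k *\<^sub>R (diff_op ^^ k) f)"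
  unfolding poly_act_def by (rule sum.mono_neutral_left) (auto simp: coeff_eq_0)

lemma diff_op_pow_linear: "linear (diff_op ^^ k)"
  by (induction k) (simp_all add: linear_compose[OF _ linear_diff_op, unfolded o_def] linear_id[unfolded id_def] id_def o_def)

lemma poly_act_add_left: "(p + q) \<star> f = p \<star> f + q \<star> f"
proof -
  let ?n = "max (degree p) (degree q)"
  show ?thesis
    by (simp add: poly_act_upto[of _ ?n] degree_add_le scaleR_add_left sum.distrib)
qed

lemma poly_act_add_right: "p \<star> (f + g) = p \<star> f + p \<star> g"
  by (simp add: poly_act_def linear_add[OF diff_op_pow_linear] scaleR_add_right sum.distrib)

lemma poly_act_scaleR: "p \<star> (a *\<^sub>R f) = a *\<^sub>R (p \<star> f)"
  by (simp add: poly_act_def linear_scale[OF diff_op_pow_linear] scaleR_sum_right mult.commute)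

lemma poly_act_0_left: "0 \<star> f = 0"
  by (simp add: poly_act_def)

lemma poly_act_pCons: "pCons a p \<star> f = a *\<^sub>R f + diff_op (p \<star> f)"
proof -
  have "pCons a p \<star> f = (\<Sum>k\<le>Suc (degree p). coeff (pCons a p) k *\<^sub>R (diff_op ^^ k) f)"
    by (rule poly_act_upto) (simp add: degree_pCons_le)
  also have "\<dots> = a *\<^sub>R f + (\<Sum>k\<le>degree p. coeff p k *\<^sub>R diff_op ((diff_op ^^ k) f))"
    by (subst sum.atMost_Suc_shift) simp
  finally show ?thesis
    by (simp add: poly_act_def linear_sum[OF linear_diff_op] linear_scale[OF linear_diff_op])
qed

lemma poly_act_smult: "smult a p \<star> f = a *\<^sub>R (p \<star> f)"
  by (simp add: poly_act_upto[of _ "degree p"] degree_smult_le scaleR_sum_right)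

lemma poly_act_mult: "(p * q) \<star> f = p \<star> q \<star> f"
  by (induction p) (simp_all add: poly_act_0_left poly_act_pCons poly_act_add_left poly_act_smult)

interpretation poly_act: Modules.module poly_act
  by standard (simp_all add: poly_act_add_right poly_act_add_left poly_act_mult
      one_pCons poly_act_pCons poly_act_0_left linear_0[OF linear_diff_op])

text \<open>
  The solution comes from variation of constants: \<open>e\<^sup>c\<^sup>t\<close> times an antiderivative of \<open>e\<^sup>-\<^sup>c\<^sup>t f\<close>.
\<close>

lemma complex_first_order_ode:
  fixes f :: "real \<Rightarrow> complex" and c :: complex
  assumes "\<And>t. isCont f t"
  obtains y where "\<And>t. (y has_vector_derivative c * y t + f t) (at t)"
proof -
  have "\<exists>F. \<forall>x. -\<infinity> < ereal x \<longrightarrow> ereal x < \<infinity> \<longrightarrow> (F has_vector_derivative exp (- c * of_real x) * f x) (at x)"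
    by (rule einterval_antiderivative) (auto intro!: continuous_intros assms)
  then obtain F where F: "\<And>x. (F has_vector_derivative exp (- c * of_real x) * f x) (at x)" by auto
  have E: "((\<lambda>t. exp (c * of_real t)) has_vector_derivative c * exp (c * of_real t)) (at t)" for t :: real
    by (rule has_vector_derivative_real_field) (auto intro!: derivative_eq_intros)
  have "((\<lambda>t. exp (c * of_real t) * F t) has_vector_derivative c * (exp (c * of_real t) * F t) + f t) (at t)" for t
  proof -
    have cancel: "exp (c * of_real t) * (exp (- c * of_real t) * f t) = f t"
      by (simp add: exp_minus)
    show ?thesis
      using has_vector_derivative_mult[OF E F, of t] unfolding cancel by (simp add: ac_simps)
  qed
  then show ?thesis by (rule that)
qed

text \<open>
  The real and imaginary parts \<open>u\<close>, \<open>v\<close> of a solution of \<open>y' = (a + \<i> b) y + \<i> g\<close>.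
\<close>

lemma real_first_order_system:
  fixes g :: "real \<Rightarrow> real" and a b :: real
  assumes g: "smooth g"
  obtains u v where "smooth u" "smooth v"
    "\<And>t. (u has_real_derivative a * u t - b * v t) (at t)"
    "\<And>t. (v has_real_derivative b * u t + a * v t + g t) (at t)"
proof -
  have "isCont (\<lambda>t. \<i> * complex_of_real (g t)) t" for t
    using smooth_DERIV[OF g, THEN DERIV_isCont] by (auto intro!: continuous_intros)
  then obtain y where y: "\<And>t. (y has_vector_derivative Complex a b * y t + \<i> * complex_of_real (g t)) (at t)"
    using complex_first_order_ode[of "\<lambda>t. \<i> * complex_of_real (g t)" "Complex a b"] by blast
  define u v where "u = (\<lambda>t. Re (y t))" and "v = (\<lambda>t. Im (y t))"
  have u: "(u has_real_derivative a * u t - b * v t) (at t)" for t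
    using bounded_linear.has_vector_derivative[OF bounded_linear_Re y]
    by (simp add: u_def v_def has_real_derivative_iff_has_vector_derivative)
  have v: "(v has_real_derivative b * u t + a * v t + g t) (at t)" for t
    using bounded_linear.has_vector_derivative[OF bounded_linear_Im y]
    by (simp add: u_def v_def has_real_derivative_iff_has_vector_derivative algebra_simps)
  \<comment> \<open>Closed under derivatives, because \<open>u'\<close> and \<open>v'\<close> are combinations of \<open>u\<close>, \<open>v\<close> and the smooth \<open>g\<close>.\<close>
  let ?X = "{(\<lambda>t. p * u t + q * v t + h t) | p q h. smooth h}"
  have X_I: "(\<lambda>t. p * u t + q * v t + h t) \<in> ?X" if "smooth h" for p q h
    using that by (intro CollectI exI conjI) simp_all
  have X: "\<exists>f'\<in>?X. \<forall>t. (f has_real_derivative f' t) (at t)" if "f \<in> ?X" for f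
  proof -
    from that obtain p q h where f: "f = (\<lambda>t. p * u t + q * v t + h t)" and h: "smooth h" by blast
    let ?f' = "\<lambda>t. (p * a + q * b) * u t + (q * a - p * b) * v t + (q * g t + 1 * deriv h t)"
    have "?f' \<in> ?X" using smooth_lincomb[OF g smooth_deriv[OF h], of q 1] by (rule X_I)
    moreover have "\<forall>t. (f has_real_derivative ?f' t) (at t)"
      unfolding f by (auto intro!: derivative_eq_intros u v smooth_DERIV[OF h] simp: algebra_simps)
    ultimately show ?thesis by (intro bexI[of _ ?f'])
  qed
  have "u \<in> ?X" using X_I[OF smooth_zero, of 1 0] by simp
  then have "smooth u" by (rule smooth_coinduct) (rule X)
  have "v \<in> ?X" using X_I[OF smooth_zero, of 0 1] by simp
  then have "smooth v" by (rule smooth_coinduct) (rule X)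
  show ?thesis by (rule that) fact+
qed

lemma first_order_system:
  obtains u v where "diff_op u = a *\<^sub>R u - b *\<^sub>R v" and "diff_op v = b *\<^sub>R u + a *\<^sub>R v + g"
proof -
  obtain u v where "smooth u" "smooth v"
    "\<And>t. (u has_real_derivative a * u t - b * v t) (at t)"
    "\<And>t. (v has_real_derivative b * u t + a * v t + Rep_smooth_fun g t) (at t)"
    using real_first_order_system[of "Rep_smooth_fun g" a b] Rep_smooth_fun by blast
  then have "diff_op (Abs_smooth_fun u) = a *\<^sub>R Abs_smooth_fun u - b *\<^sub>R Abs_smooth_fun v"
    "diff_op (Abs_smooth_fun v) = b *\<^sub>R Abs_smooth_fun u + a *\<^sub>R Abs_smooth_fun v + g"
    by (auto simp: Rep_smooth_fun_inject[symmetric] fun_eq_iff diff_op.rep_eq plus_smooth_fun.rep_eq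
        minus_smooth_fun.rep_eq scaleR_smooth_fun.rep_eq Abs_smooth_fun_inverse intro!: DERIV_imp_deriv)
  then show ?thesis by (rule that)
qed

lemma linear_factor_act: "[:- a, 1:] \<star> f = diff_op f - a *\<^sub>R f"
  by (simp add: poly_act_pCons poly_act_0_left linear_0[OF linear_diff_op])

text \<open>
  With \<open>b = 0\<close> the second equation of the system decouples and becomes the scalar equation.
\<close>

lemma linear_factor_surj: "\<exists>y. [:- a, 1:] \<star> y = f"
proof -
  obtain u v where "diff_op v = 0 *\<^sub>R u + a *\<^sub>R v + f" by (rule first_order_system)
  then show ?thesis by (intro exI[of _ v]) (simp add: linear_factor_act)
qed

text \<open>
  Real irreducible quadratic factors have the form \<open>(\<xi> - a)\<^sup>2 + b\<^sup>2\<close>. In the first-order system above,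
  eliminating \<open>v\<close> leaves the equation \<open>((D - a)\<^sup>2 + b\<^sup>2) u = - b g\<close>, so \<open>g = - f / b\<close> is the right
  forcing term.
\<close>

lemma quadratic_factor_surj:
  assumes "b \<noteq> 0"
  shows "\<exists>y. [:a\<^sup>2 + b\<^sup>2, - 2 * a, 1:] \<star> y = f"
proof -
  obtain u v where u: "diff_op u = a *\<^sub>R u - b *\<^sub>R v"
    and v: "diff_op v = b *\<^sub>R u + a *\<^sub>R v + (- 1 / b) *\<^sub>R f"
    by (rule first_order_system)
  have "[:a\<^sup>2 + b\<^sup>2, - 2 * a, 1:] = [:- a, 1:] * [:- a, 1:] + [:b\<^sup>2:]"
    by (simp add: power2_eq_square)
  then have "[:a\<^sup>2 + b\<^sup>2, - 2 * a, 1:] \<star> u = [:- a, 1:] \<star> [:- a, 1:] \<star> u + b\<^sup>2 *\<^sub>R u"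
    by (simp only: poly_act_add_left poly_act_mult) (simp add: poly_act_pCons poly_act_0_left linear_0[OF linear_diff_op])
  also have "[:- a, 1:] \<star> u = (- b) *\<^sub>R v" by (simp add: linear_factor_act u)
  also have "[:- a, 1:] \<star> (- b) *\<^sub>R v = (- b) *\<^sub>R (b *\<^sub>R u + (- 1 / b) *\<^sub>R f)"
    by (simp only: poly_act_scaleR) (simp add: linear_factor_act v)
  also have "\<dots> + b\<^sup>2 *\<^sub>R u = f"
    using assms by (simp add: scaleR_diff_right scaleR_add_right power2_eq_square)
  finally show ?thesis by blast
qed

text \<open>
  A complex root \<open>a + \<i> b\<close> is real and gives a linear factor, or the quadratic with the roots
  \<open>a \<plusminus> \<i> b\<close> is a factor: the remainder of the division by it is real, of degree at most one, and
  has a nonreal root, hence vanishes.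
\<close>

lemma real_poly_linear_or_quadratic_factor:
  fixes p :: "real poly"
  assumes "degree p \<noteq> 0"
  obtains a where "[:- a, 1:] dvd p" | a b where "b \<noteq> 0" "[:a\<^sup>2 + b\<^sup>2, - 2 * a, 1:] dvd p"
proof -
  interpret of_real_poly: map_poly_comm_ring_hom complex_of_real ..
  have "degree (map_poly complex_of_real p) \<noteq> 0" using assms by (simp add: degree_map_poly)
  then have "\<not> constant (poly (map_poly complex_of_real p))" by (simp add: constant_degree)
  then obtain z where z: "poly (map_poly complex_of_real p) z = 0"
    using fundamental_theorem_of_algebra by blast
  obtain a b where ab: "z = Complex a b" by (cases z)
  show ?thesis
  proof (cases "b = 0")
    case True
    then have "z = complex_of_real a" using ab by (simp add: complex_eq_iff)
    with z have "poly p a = 0" by simp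
    then show ?thesis using that(1) by (simp add: poly_eq_0_iff_dvd)
  next
    case False
    let ?q = "[:a\<^sup>2 + b\<^sup>2, - 2 * a, 1:]"
    have "degree (p mod ?q) < 2" using degree_mod_less[of ?q p] by (auto simp: numeral_2_eq_2)
    moreover obtain c s where cs: "p mod ?q = pCons c s" by (rule pCons_cases)
    ultimately have "degree s = 0" by (cases "s = 0") auto
    then obtain d where "s = [:d:]" by (rule degree_eq_zeroE)
    with cs have r: "p mod ?q = [:c, d:]" by simp
    have p: "p = p div ?q * ?q + [:c, d:]" using r by (metis div_mult_mod_eq)
    have "poly (map_poly complex_of_real p) z = poly (map_poly complex_of_real (p div ?q * ?q)) z
        + poly (map_poly complex_of_real [:c, d:]) z"
      by (subst p) (simp add: of_real_poly.hom_add)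
    also have "poly (map_poly complex_of_real (p div ?q * ?q)) z
      = poly (map_poly complex_of_real (p div ?q)) z * poly (map_poly complex_of_real ?q) z"
      by (simp only: of_real_poly.hom_mult poly_mult)
    also have "poly (map_poly complex_of_real ?q) z = 0"
      by (simp add: map_poly_pCons ab complex_eq_iff power2_eq_square algebra_simps)
    also have "poly (map_poly complex_of_real [:c, d:]) z = Complex (c + a * d) (b * d)"
      by (simp add: of_real_hom.map_poly_pCons_hom ab complex_eq_iff)
    finally have "Complex (c + a * d) (b * d) = 0" using z by simp
    then have "d = 0" "c = 0" using False by (auto simp: complex_eq_iff)
    with r have "?q dvd p" by (simp add: dvd_eq_mod_eq_0)
    with False that(2) show ?thesis by blast
  qed
qed

text \<open>
  Surjectivity passes to products of polynomials, so it need only be known for the linear and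
  quadratic factors.
\<close>

lemma poly_act_surj: "p \<noteq> 0 \<Longrightarrow> \<exists>y. p \<star> y = f"
proof (induction "degree p" arbitrary: p f rule: less_induct)
  case less
  have factor: "\<exists>y. p \<star> y = f"
    if "q dvd p" "degree q > 0" and q: "\<And>f. \<exists>y. q \<star> y = f" for q
  proof -
    obtain r where r: "p = q * r" using \<open>q dvd p\<close> by blast
    with less.prems have "q \<noteq> 0" "r \<noteq> 0" by auto
    then have "degree r < degree p" using r \<open>degree q > 0\<close> by (simp add: degree_mult_eq)
    obtain x where x: "q \<star> x = f" using q by blast
    obtain y where y: "r \<star> y = x"
      using less.hyps[OF \<open>degree r < degree p\<close> \<open>r \<noteq> 0\<close>] by blast
    have "p \<star> y = f" by (simp only: r poly_act_mult x y)
    then show ?thesis by blast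
  qed
  show ?case
  proof (cases "degree p = 0")
    case True
    then obtain c where "p = [:c:]" by (rule degree_eq_zeroE)
    then show ?thesis using less.prems
      by (intro exI[of _ "(1 / c) *\<^sub>R f"]) (simp add: poly_act_pCons poly_act_0_left linear_0[OF linear_diff_op])
  next
    case False
    then show ?thesis
    proof (rule real_poly_linear_or_quadratic_factor)
      fix a assume "[:- a, 1:] dvd p"
      then show ?thesis by (rule factor) (simp, rule linear_factor_surj)
    next
      fix a b :: real assume "b \<noteq> 0" "[:a\<^sup>2 + b\<^sup>2, - 2 * a, 1:] dvd p"
      then show ?thesis by (intro factor[OF _ _ quadratic_factor_surj]) simp_all
    qed
  qed
qed

interpretation poly_act: divisible_module poly_act
  by standard (rule poly_act_surj)

section \<open>Ranks and polynomial left annihilators\<close>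

lemma sum_fun_apply: "(\<Sum>x\<in>A. f x) i = (\<Sum>x\<in>A. f x i)"
  by (induction A rule: infinite_finite_induct) simp_all

lemma (in Vector_Spaces.vector_space) dim_insert_notin_span:
  assumes "finite S" "x \<notin> span S"
  shows "dim (insert x S) = Suc (dim S)"
proof -
  obtain B where B: "B \<subseteq> S" "independent B" "S \<subseteq> span B" "card B = dim S"
    by (rule basis_exists)
  have "x \<notin> span B" using assms(2) span_mono[OF B(1)] by blast
  have "dim (insert x S) = card (insert x B)"
  proof (rule basis_card_eq_dim[symmetric])
    show "insert x B \<subseteq> insert x S" using B(1) by blast
    show "insert x S \<subseteq> span (insert x B)"
      using B(3) span_mono[of B "insert x B"] span_base[of x "insert x B"] by auto
    show "independent (insert x B)" using B(2) \<open>x \<notin> span B\<close> by (simp add: independent_insert)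
  qed
  also have "\<dots> = Suc (dim S)"
    using B(4) \<open>x \<notin> span B\<close> finite_subset[OF B(1) assms(1)] span_base[of x B]
    by (metis card_insert_disjoint)
  finally show ?thesis .
qed

lemma (in Vector_Spaces.vector_space) subset_span_if_dim_eq:
  assumes "finite T" "S \<subseteq> T" "dim S = dim T"
  shows "T \<subseteq> span S"
proof -
  obtain B where B: "B \<subseteq> S" "independent B" "S \<subseteq> span B" "card B = dim S"
    by (rule basis_exists)
  have "B \<subseteq> T" using B(1) assms(2) by blast
  then obtain B' where B': "B \<subseteq> B'" "B' \<subseteq> T" "independent B'" "T \<subseteq> span B'"
    by (rule maximal_independent_subset_extend[OF _ B(2)])
  have "card B' = dim T" by (rule basis_card_eq_dim) fact+
  then have "card B = card B'" using B(4) assms(3) by simp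
  then have "B = B'"
    using card_subset_eq[OF finite_subset[OF B'(2) assms(1)] B'(1)] by simp
  then show ?thesis using B'(4) span_mono[OF B(1)] by blast
qed

text \<open>
  Extending vectors by zero embeds the coordinate spaces of all dimensions into the one vector space of
  functions on \<open>nat\<close>, where columns of matrices with different numbers of rows can be compared.
\<close>

definition zero_extension :: "'a :: zero vec \<Rightarrow> nat \<Rightarrow> 'a" where
  "zero_extension v i = (if i < dim_vec v then v $ i else 0)"

interpretation fun_space: Vector_Spaces.vector_space "\<lambda>(c :: 'a :: field) f (i :: nat). c * f i"
  by standard (simp_all add: fun_eq_iff algebra_simps)

lemma inj_on_zero_extension: "inj_on zero_extension (carrier_vec m)"
proof (rule inj_onI)
  fix v w :: "'a vec"
  assume dims: "v \<in> carrier_vec m" "w \<in> carrier_vec m" and eq: "zero_extension v = zero_extension w"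
  have "v $ i = w $ i" if "i < m" for i
    using fun_cong[OF eq, of i] dims that by (simp add: zero_extension_def)
  with dims show "v = w" by (intro eq_vecI) auto
qed

lemma lin_dep_iff_dependent:
  fixes S :: "'a :: field vec set"
  assumes "finite S" "S \<subseteq> carrier_vec m"
  shows "LinearCombinations.module.lin_dep class_ring (module_vec TYPE('a) m) S
    \<longleftrightarrow> fun_space.dependent (zero_extension ` S)"
proof -
  interpret V: vec_space "TYPE('a)" m .
  have inj: "inj_on zero_extension S"
    using inj_on_subset[OF inj_on_zero_extension assms(2)] .
  have ext0: "(\<Sum>v\<in>S. a v * zero_extension v i) = 0" if "i \<ge> m" for a i
    using assms(2) that by (intro sum.neutral) (auto simp: zero_extension_def)
  have ext1: "(\<Sum>v\<in>S. a v * zero_extension v i) = (\<Sum>v\<in>S. a v * v $ i)" if "i < m" for a i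
    using assms(2) that by (intro sum.cong) (auto simp: zero_extension_def)
  have lincomb: "V.lincomb a S = 0\<^sub>v m \<longleftrightarrow> (\<Sum>v\<in>S. (\<lambda>i. a v * zero_extension v i)) = 0" for a
  proof -
    have "V.lincomb a S = 0\<^sub>v m \<longleftrightarrow> (\<forall>i<m. (\<Sum>v\<in>S. a v * v $ i) = 0)"
      using V.lincomb_index[OF _ assms(2)] V.lincomb_dim[OF assms] by (auto simp: vec_eq_iff)
    also have "\<dots> \<longleftrightarrow> (\<forall>i. (\<Sum>v\<in>S. a v * zero_extension v i) = 0)"
      using ext0 ext1 by (metis not_le)
    finally show ?thesis by (simp add: fun_eq_iff sum_fun_apply)
  qed
  have "V.lin_dep S \<longleftrightarrow> (\<exists>a. (\<exists>v\<in>S. a v \<noteq> 0) \<and> V.lincomb a S = 0\<^sub>v m)"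
  proof
    assume "V.lin_dep S"
    from V.finite_lin_dep[OF assms(1) this] assms(2)
    show "\<exists>a. (\<exists>v\<in>S. a v \<noteq> 0) \<and> V.lincomb a S = 0\<^sub>v m" by auto
  next
    assume "\<exists>a. (\<exists>v\<in>S. a v \<noteq> 0) \<and> V.lincomb a S = 0\<^sub>v m"
    then show "V.lin_dep S" using assms(1) by (auto simp: V.lin_dep_def)
  qed
  also have "\<dots> \<longleftrightarrow> (\<exists>a. (\<exists>v\<in>S. a v \<noteq> 0) \<and> (\<Sum>v\<in>S. (\<lambda>i. a v * zero_extension v i)) = 0)"
    by (simp add: lincomb)
  also have "\<dots> \<longleftrightarrow> (\<exists>u. (\<exists>v\<in>S. u (zero_extension v) \<noteq> 0) \<and>
      (\<Sum>v\<in>S. (\<lambda>i. u (zero_extension v) * zero_extension v i)) = 0)" (is "?L \<longleftrightarrow> ?R")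
  proof
    assume ?L
    then obtain a where a: "\<exists>v\<in>S. a v \<noteq> 0" "(\<Sum>v\<in>S. (\<lambda>i. a v * zero_extension v i)) = 0" by blast
    let ?u = "\<lambda>f. a (inv_into S zero_extension f)"
    have "(\<Sum>v\<in>S. (\<lambda>i. ?u (zero_extension v) * zero_extension v i)) = (\<Sum>v\<in>S. (\<lambda>i. a v * zero_extension v i))"
      by (intro sum.cong) (simp_all add: inv_into_f_f[OF inj])
    with a show ?R by (intro exI[of _ ?u]) (auto simp: inv_into_f_f[OF inj])
  next
    assume ?R
    then obtain u where "(\<exists>v\<in>S. u (zero_extension v) \<noteq> 0) \<and>
      (\<Sum>v\<in>S. (\<lambda>i. u (zero_extension v) * zero_extension v i)) = 0" by (elim exE)
    then show ?L by (intro exI[of _ "\<lambda>v. u (zero_extension v)"])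
  qed
  also have "\<dots> \<longleftrightarrow> fun_space.dependent (zero_extension ` S)"
    using assms(1) by (simp add: fun_space.dependent_finite sum.reindex[OF inj])
  finally show ?thesis .
qed

text \<open>
  Both sides count a maximal independent set of columns.
\<close>

lemma rank_eq_dim_columns:
  fixes A :: "'a :: field mat"
  assumes "A \<in> carrier_mat m n"
  shows "vec_space.rank m A = fun_space.dim (zero_extension ` set (cols A))"
proof -
  interpret V: vec_space "TYPE('a)" m .
  have carrier: "set (cols A) \<subseteq> carrier_vec m" using assms cols_dim by blast
  let ?P = "\<lambda>T. T \<subseteq> set (cols A) \<and> V.lin_indpt T"
  obtain S where S: "finite S" "maximal S ?P"
    using maximal_exists_superset[of "set (cols A)" ?P "{}"]
    by (auto simp: V.lin_dep_def)
  then have "S \<subseteq> set (cols A)" "V.lin_indpt S" by (auto simp: maximal_def)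
  have "fun_space.dim (zero_extension ` set (cols A)) = card (zero_extension ` S)"
  proof (rule fun_space.basis_card_eq_dim[symmetric])
    show "zero_extension ` S \<subseteq> zero_extension ` set (cols A)"
      using \<open>S \<subseteq> set (cols A)\<close> by blast
    show indep: "fun_space.independent (zero_extension ` S)"
      using lin_dep_iff_dependent[of S m] S(1) \<open>S \<subseteq> set (cols A)\<close> carrier \<open>V.lin_indpt S\<close> by auto
    show "zero_extension ` set (cols A) \<subseteq> fun_space.span (zero_extension ` S)"
    proof (rule image_subsetI)
      fix c assume c: "c \<in> set (cols A)"
      show "zero_extension c \<in> fun_space.span (zero_extension ` S)"
      proof (cases "c \<in> S")
        case True
        then show ?thesis by (intro fun_space.span_base) simp
      next
        case False
        then have "V.lin_dep (insert c S)"
          using S(2) c \<open>S \<subseteq> set (cols A)\<close> by (auto simp: maximal_def)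
        then have "fun_space.dependent (insert (zero_extension c) (zero_extension ` S))"
          using lin_dep_iff_dependent[of "insert c S" m] S(1) c \<open>S \<subseteq> set (cols A)\<close> carrier by auto
        then show ?thesis using indep by (metis fun_space.independent_insert fun_space.span_base)
      qed
    qed
  qed
  also have "\<dots> = card S"
    using \<open>S \<subseteq> set (cols A)\<close> carrier by (intro card_image inj_on_subset[OF inj_on_zero_extension]) auto
  finally show ?thesis using V.rank_card_indpt[OF assms S(2)] by simp
qed

text \<open>
  With the fraction field as the module, the solvability criterion tests membership in a column space
  over that field by annihilators with entries in the ring, so no denominators have to be cleared.
\<close>

interpretation fract_act: divisible_module "\<lambda>(p :: 'r :: euclidean_ring) x. to_fract p * x"
proof
  fix p :: 'r and y :: "'r fract"
  assume "p \<noteq> 0"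
  then show "\<exists>x. to_fract p * x = y" by (intro exI[of _ "y / to_fract p"]) simp
qed (simp_all add: algebra_simps)

definition unit_fun :: "nat \<Rightarrow> nat \<Rightarrow> 'a :: field" where
  "unit_fun i = (\<lambda>l. if l = i then 1 else 0)"

text \<open>
  Adding unit functions at positions where all given functions vanish raises the dimension by one each.
\<close>

lemma dim_Un_unit_funs:
  assumes "finite U" and "\<And>f l. f \<in> U \<Longrightarrow> l \<ge> g \<Longrightarrow> f l = 0"
  shows "fun_space.dim (U \<union> unit_fun ` {g..<g + k}) = fun_space.dim U + k"
proof (induction k)
  case (Suc k)
  let ?W = "U \<union> unit_fun ` {g..<g + k} :: (nat \<Rightarrow> 'a) set"
  have "f (g + k) = 0" if "f \<in> fun_space.span ?W" for f
    using that
    by (induction rule: fun_space.span_induct_alt) (auto simp: unit_fun_def assms(2))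
  from this[of "unit_fun (g + k)"] have "unit_fun (g + k) \<notin> fun_space.span ?W"
    by (auto simp: unit_fun_def)
  then have "fun_space.dim (insert (unit_fun (g + k)) ?W) = Suc (fun_space.dim ?W)"
    using assms(1) by (intro fun_space.dim_insert_notin_span) auto
  moreover have "insert (unit_fun (g + k)) ?W = U \<union> unit_fun ` {g..<g + Suc k}"
    by (auto simp: less_Suc_eq)
  ultimately show ?case using Suc by simp
qed simp

text \<open>
  Appending \<open>k\<close> rows raises the rank by at most \<open>k\<close>, and by exactly \<open>k\<close> if the appended rows are
  independent of each other and of the rows above; here independence is tested with polynomial
  coefficients only. Columns make the comparison possible: modulo the unit vectors \<open>E\<close> at the new
  positions the columns of \<open>A\<close> and \<open>G\<close> agree, so the column space of \<open>A\<close> together with \<open>E\<close> has dimension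
  \<open>prank G + k\<close>. The rank of \<open>A\<close> reaches this number exactly if \<open>E\<close> lies in the column space, and
  whether it does is decided by the solvability criterion over the fraction field.
\<close>

lemma prank_append_rows_iff:
  assumes A: "A \<in> carrier_mat (g + k) n" and G: "G \<in> carrier_mat g n"
    and top: "\<And>i j. i < g \<Longrightarrow> j < n \<Longrightarrow> A $$ (i, j) = G $$ (i, j)"
  shows "prank A = prank G + k \<longleftrightarrow>
    (\<forall>u. (\<forall>j<n. (\<Sum>l<g + k. u l * A $$ (l, j)) = 0) \<longrightarrow> (\<forall>i\<in>{g..<g + k}. u i = 0))"
proof -
  define column where "column B j = (\<lambda>i. if i < dim_row B then to_fract (B $$ (i, j)) else 0)"
    for B :: "real poly mat" and j
  have prank: "prank B = fun_space.dim (column B ` {..<dim_col B})" for B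
  proof -
    have "zero_extension (col (map_mat to_fract B) j) = column B j" if "j < dim_col B" for j
      using that by (simp add: column_def zero_extension_def fun_eq_iff)
    then have "zero_extension ` set (cols (map_mat to_fract B)) = column B ` {..<dim_col B}"
      by (auto simp: cols_def image_image atLeast0LessThan)
    then show ?thesis
      unfolding prank_def by (subst rank_eq_dim_columns[of _ _ "dim_col B"]) auto
  qed
  define T U E where "T = column A ` {..<n}" and "U = column G ` {..<n}"
    and "E = (unit_fun ` {g..<g + k} :: (nat \<Rightarrow> real poly fract) set)"
  have fin: "finite T" "finite U" "finite E" by (simp_all add: T_def U_def E_def)
  \<comment> \<open>The part of the columns of \<open>A\<close> in the appended rows.\<close>
  define r where "r j = (\<Sum>i\<in>{g..<g + k}. (\<lambda>l. to_fract (A $$ (i, j)) * unit_fun i l))" for j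
  have r_apply: "r j l = (if l \<in> {g..<g + k} then to_fract (A $$ (l, j)) else 0)" for j l
  proof -
    have "r j l = (\<Sum>i\<in>{g..<g + k}. to_fract (A $$ (i, j)) * unit_fun i l)"
      by (simp add: r_def sum_fun_apply)
    then show ?thesis by (simp add: unit_fun_def if_distrib cong: if_cong)
  qed
  have split: "column A j = column G j + r j" if "j < n" for j
    using A G top that by (auto simp: column_def fun_eq_iff r_apply)
  have r_span: "r j \<in> fun_space.span E" for j
    unfolding r_def E_def by (intro fun_space.span_sum fun_space.span_scale fun_space.span_base) simp
  have "fun_space.span (T \<union> E) = fun_space.span (U \<union> E)"
  proof (rule fun_space.span_eq[THEN iffD2], intro conjI Un_least)
    show "T \<subseteq> fun_space.span (U \<union> E)"
    proof
      fix f assume "f \<in> T"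
      then obtain j where "j < n" "f = column G j + r j" by (auto simp: T_def split)
      moreover have "column G j \<in> fun_space.span (U \<union> E)"
        using \<open>j < n\<close> by (intro fun_space.span_base) (simp add: U_def)
      moreover have "r j \<in> fun_space.span (U \<union> E)"
        using r_span[of j] fun_space.span_mono[of E "U \<union> E"] by blast
      ultimately show "f \<in> fun_space.span (U \<union> E)" by (simp only: fun_space.span_add)
    qed
    show "U \<subseteq> fun_space.span (T \<union> E)"
    proof
      fix f assume "f \<in> U"
      then obtain j where "j < n" "f = column A j - r j" by (auto simp: U_def split)
      moreover have "column A j \<in> fun_space.span (T \<union> E)"
        using \<open>j < n\<close> by (intro fun_space.span_base) (simp add: T_def)
      moreover have "r j \<in> fun_space.span (T \<union> E)"
        using r_span[of j] fun_space.span_mono[of E "T \<union> E"] by blast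
      ultimately show "f \<in> fun_space.span (T \<union> E)" by (simp only: fun_space.span_diff)
    qed
  qed (auto intro: fun_space.span_base)
  then have "fun_space.dim (T \<union> E) = fun_space.dim (U \<union> E)" by (rule fun_space.span_eq_dim)
  also have "\<dots> = fun_space.dim U + k"
    unfolding E_def using G by (intro dim_Un_unit_funs) (auto simp: U_def column_def)
  finally have dim: "fun_space.dim (T \<union> E) = prank G + k" using G by (simp add: prank U_def)
  have "prank A = fun_space.dim T" using A by (simp add: prank T_def)
  then have "prank A = prank G + k \<longleftrightarrow> fun_space.dim T = fun_space.dim (T \<union> E)"
    using dim by simp
  also have "\<dots> \<longleftrightarrow> E \<subseteq> fun_space.span T"
  proof
    assume "fun_space.dim T = fun_space.dim (T \<union> E)"
    then show "E \<subseteq> fun_space.span T"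
      using fun_space.subset_span_if_dim_eq[of "T \<union> E" T] fin by auto
  next
    assume "E \<subseteq> fun_space.span T"
    then have "fun_space.span T = fun_space.span (T \<union> E)"
      by (intro fun_space.span_eq[THEN iffD2]) (auto intro: fun_space.span_base)
    then show "fun_space.dim T = fun_space.dim (T \<union> E)" by (rule fun_space.span_eq_dim)
  qed
  also have "\<dots> \<longleftrightarrow> (\<forall>u. (\<forall>j<n. (\<Sum>l<g + k. u l * A $$ (l, j)) = 0) \<longrightarrow> (\<forall>i\<in>{g..<g + k}. u i = 0))"
    (is "_ \<longleftrightarrow> ?ann")
  proof
    assume ?ann
    show "E \<subseteq> fun_space.span T"
      unfolding E_def
    proof (rule image_subsetI)
      fix i assume i: "i \<in> {g..<g + k}"
      have "(\<Sum>l<g + k. to_fract (u l) * unit_fun i l) = (0 :: real poly fract)"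
        if "\<forall>j<n. (\<Sum>l<g + k. u l * A $$ (l, j)) = 0" for u
        using \<open>?ann\<close> that i by (auto simp: unit_fun_def if_distrib cong: if_cong)
      then obtain x where x: "\<And>l. l < g + k \<Longrightarrow> (\<Sum>j<n. to_fract (A $$ (l, j)) * x j) = unit_fun i l"
        using fract_act.solvable_iff_annihilators[where I = "{..<g + k}" and n = n
            and A = "\<lambda>l j. A $$ (l, j)" and y = "unit_fun i"]
        by auto
      have "unit_fun i = (\<Sum>j<n. (\<lambda>l. x j * column A j l))"
      proof
        fix l
        have "(\<Sum>j<n. (\<lambda>l. x j * column A j l)) l = (\<Sum>j<n. x j * column A j l)"
          by (rule sum_fun_apply)
        also have "\<dots> = unit_fun i l"
          using A i x[of l] by (cases "l < g + k") (auto simp: column_def mult.commute unit_fun_def)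
        finally show "unit_fun i l = (\<Sum>j<n. (\<lambda>l. x j * column A j l)) l" by simp
      qed
      moreover have "column A j \<in> fun_space.span T" if "j < n" for j
        using that by (intro fun_space.span_base) (simp add: T_def)
      ultimately show "unit_fun i \<in> fun_space.span T"
        by (auto intro!: fun_space.span_sum fun_space.span_scale)
    qed
  next
    assume E: "E \<subseteq> fun_space.span T"
    show ?ann
    proof (intro allI impI ballI)
      fix u i
      assume u: "\<forall>j<n. (\<Sum>l<g + k. u l * A $$ (l, j)) = 0" and i: "i \<in> {g..<g + k}"
      have "(\<Sum>l<g + k. to_fract (u l) * f l) = 0" if "f \<in> fun_space.span T" for f
        using that
      proof (induction rule: fun_space.span_induct_alt)
        case (step c f h)
        then obtain j where j: "j < n" "f = column A j" by (auto simp: T_def)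
        have "(\<Sum>l<g + k. to_fract (u l) * f l) = to_fract (\<Sum>l<g + k. u l * A $$ (l, j))"
          using A by (simp add: j(2) column_def)
        then have "(\<Sum>l<g + k. to_fract (u l) * f l) = 0" using u j(1) by simp
        moreover have "(\<Sum>l<g + k. to_fract (u l) * ((\<lambda>i. c * f i) + h) l)
            = c * (\<Sum>l<g + k. to_fract (u l) * f l) + (\<Sum>l<g + k. to_fract (u l) * h l)"
          by (simp add: distrib_left sum.distrib sum_distrib_left mult.left_commute)
        ultimately show ?case using step by simp
      qed simp
      moreover have "unit_fun i \<in> fun_space.span T"
        using E i by (auto simp: E_def image_subset_iff)
      ultimately have "(\<Sum>l<g + k. to_fract (u l) * unit_fun i l) = 0" by blast
      then show "u i = 0" using i by (simp add: unit_fun_def if_distrib cong: if_cong)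
    qed
  qed
  finally show ?thesis .
qed

lemma sum_lessThan_add:
  fixes f :: "nat \<Rightarrow> 'a :: comm_monoid_add"
  shows "(\<Sum>l<m + n. f l) = (\<Sum>l<m. f l) + (\<Sum>l<n. f (m + l))"
  by (induction n) (simp_all add: add.assoc)

lemma prank_no_rows: "prank (0\<^sub>m 0 n) = 0"
proof -
  have "map_mat to_fract (0\<^sub>m 0 n :: real poly mat) = 0\<^sub>m 0 n" by (intro eq_matI) auto
  then show ?thesis by (simp add: prank_def vec_space.rank_0I)
qed

lemma full_row_prank_iff:
  assumes "C \<in> carrier_mat k n"
  shows "prank C = k \<longleftrightarrow> (\<forall>v. (\<forall>j<n. (\<Sum>i<k. v i * C $$ (i, j)) = 0) \<longrightarrow> (\<forall>i<k. v i = 0))"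
  using prank_append_rows_iff[of C 0 k n "0\<^sub>m 0 n"] assms
  by (simp add: prank_no_rows Ball_def)

text \<open>
  Regularity of a controller without ranks: the controller equations are independent of each other and
  of the equations \<open>u M c = 0\<close> with \<open>u R = 0\<close>, which the plant itself imposes on \<open>c\<close>.
\<close>

lemma regular_rank_iff:
  assumes R: "R \<in> carrier_mat g nw" and M: "M \<in> carrier_mat g nc" and C: "C \<in> carrier_mat k nc"
  shows "prank (four_block_mat R M (0\<^sub>m k nw) C) =
      prank (four_block_mat R M (0\<^sub>m 0 nw) (0\<^sub>m 0 nc)) + k \<longleftrightarrow>
    (\<forall>u v. (\<forall>j<nw. (\<Sum>l<g. u l * R $$ (l, j)) = 0) \<longrightarrow>
       (\<forall>j<nc. (\<Sum>l<g. u l * M $$ (l, j)) + (\<Sum>i<k. v i * C $$ (i, j)) = 0) \<longrightarrow>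
       (\<forall>i<k. v i = 0))" (is "?rank \<longleftrightarrow> ?ann")
proof -
  let ?A = "four_block_mat R M (0\<^sub>m k nw) C"
  let ?G = "four_block_mat R M (0\<^sub>m 0 nw) (0\<^sub>m 0 nc)"
  have dims: "?A \<in> carrier_mat (g + k) (nw + nc)" "?G \<in> carrier_mat g (nw + nc)"
    using R M C by auto
  have top: "?A $$ (i, j) = ?G $$ (i, j)" if "i < g" "j < nw + nc" for i j
    using that R M C by simp
  have entries: "(\<Sum>l<g + k. w l * ?A $$ (l, j)) =
      (if j < nw then \<Sum>l<g. w l * R $$ (l, j)
       else (\<Sum>l<g. w l * M $$ (l, j - nw)) + (\<Sum>i<k. w (g + i) * C $$ (i, j - nw)))"
    if "j < nw + nc" for w j
    using that R M C by (simp add: sum_lessThan_add)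
  define kills_R where "kills_R u \<longleftrightarrow> (\<forall>j<nw. (\<Sum>l<g. u l * R $$ (l, j)) = 0)" for u
  define kills_MC where "kills_MC u v \<longleftrightarrow>
    (\<forall>j<nc. (\<Sum>l<g. u l * M $$ (l, j)) + (\<Sum>i<k. v i * C $$ (i, j)) = 0)" for u v
  have ann: "(\<forall>j<nw + nc. (\<Sum>l<g + k. w l * ?A $$ (l, j)) = 0) \<longleftrightarrow>
      kills_R w \<and> kills_MC w (\<lambda>i. w (g + i))" for w
  proof
    assume all: "\<forall>j<nw + nc. (\<Sum>l<g + k. w l * ?A $$ (l, j)) = 0"
    have "(\<Sum>l<g. w l * R $$ (l, j)) = 0" if "j < nw" for j
      using all[rule_format, of j] entries[of j w] that by simp
    moreover have "(\<Sum>l<g. w l * M $$ (l, j)) + (\<Sum>i<k. w (g + i) * C $$ (i, j)) = 0" if "j < nc" for j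
      using all[rule_format, of "nw + j"] entries[of "nw + j" w] that by simp
    ultimately show "kills_R w \<and> kills_MC w (\<lambda>i. w (g + i))"
      unfolding kills_R_def kills_MC_def by blast
  next
    assume "kills_R w \<and> kills_MC w (\<lambda>i. w (g + i))"
    then show "\<forall>j<nw + nc. (\<Sum>l<g + k. w l * ?A $$ (l, j)) = 0"
      by (simp add: entries kills_R_def kills_MC_def)
  qed
  have "?rank \<longleftrightarrow> (\<forall>w. kills_R w \<and> kills_MC w (\<lambda>i. w (g + i)) \<longrightarrow> (\<forall>i\<in>{g..<g + k}. w i = 0))"
    using prank_append_rows_iff[OF dims top] ann by simp
  also have "\<dots> \<longleftrightarrow> (\<forall>u v. kills_R u \<longrightarrow> kills_MC u v \<longrightarrow> (\<forall>i<k. v i = 0))"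
  proof
    assume L: "\<forall>w. kills_R w \<and> kills_MC w (\<lambda>i. w (g + i)) \<longrightarrow> (\<forall>i\<in>{g..<g + k}. w i = 0)"
    show "\<forall>u v. kills_R u \<longrightarrow> kills_MC u v \<longrightarrow> (\<forall>i<k. v i = 0)"
    proof (intro allI impI)
      fix u v i assume "kills_R u" "kills_MC u v" "i < k"
      let ?w = "\<lambda>l. if l < g then u l else v (l - g)"
      have "kills_R ?w" using \<open>kills_R u\<close> by (simp add: kills_R_def)
      moreover have "kills_MC ?w (\<lambda>i. ?w (g + i))" using \<open>kills_MC u v\<close> by (simp add: kills_MC_def)
      ultimately have "\<forall>i\<in>{g..<g + k}. ?w i = 0"
        using L[THEN spec, of ?w] by blast
      from this[THEN bspec, of "g + i"] \<open>i < k\<close> show "v i = 0" by simp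
    qed
  next
    assume R: "\<forall>u v. kills_R u \<longrightarrow> kills_MC u v \<longrightarrow> (\<forall>i<k. v i = 0)"
    show "\<forall>w. kills_R w \<and> kills_MC w (\<lambda>i. w (g + i)) \<longrightarrow> (\<forall>i\<in>{g..<g + k}. w i = 0)"
    proof (intro allI impI ballI)
      fix w i
      assume "kills_R w \<and> kills_MC w (\<lambda>i. w (g + i))" and i: "i \<in> {g..<g + k}"
      then have "\<forall>i<k. w (g + i) = 0"
        using R[THEN spec, THEN spec, of w "\<lambda>i. w (g + i)"] by blast
      moreover have "i - g < k" using i by auto
      ultimately have "w (g + (i - g)) = 0" by blast
      then show "w i = 0" using i by simp
    qed
  qed
  finally show ?thesis unfolding kills_R_def kills_MC_def .
qed

section \<open>Enlarging a regular controller by the kernel of the control matrix\<close>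

definition traj :: "nat \<Rightarrow> (nat \<Rightarrow> smooth_fun) \<Rightarrow> real \<Rightarrow> real vec" where
  "traj q X t = vec q (\<lambda>j. Rep_smooth_fun (X j) t)"

lemma smooth_traj_eq_range: "smooth_traj q = range (traj q)"
proof
  show "range (traj q) \<subseteq> smooth_traj q"
    using Rep_smooth_fun by (auto simp: smooth_traj_def traj_def)
  show "smooth_traj q \<subseteq> range (traj q)"
  proof
    fix x assume x: "x \<in> smooth_traj q"
    have "x = traj q (\<lambda>j. Abs_smooth_fun (\<lambda>t. x t $ j))"
    proof
      fix t
      show "x t = traj q (\<lambda>j. Abs_smooth_fun (\<lambda>t. x t $ j)) t"
        using x by (intro eq_vecI) (simp_all add: smooth_traj_def traj_def Abs_smooth_fun_inverse)
    qed
    then show "x \<in> range (traj q)" by blast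
  qed
qed

definition mat_act :: "real poly mat \<Rightarrow> (nat \<Rightarrow> smooth_fun) \<Rightarrow> nat \<Rightarrow> smooth_fun" where
  "mat_act A X i = (\<Sum>j<dim_col A. A $$ (i, j) \<star> X j)"

lemma mat_diff_traj:
  "mat_diff A (traj (dim_col A) X) t = vec (dim_row A) (\<lambda>i. Rep_smooth_fun (mat_act A X i) t)"
proof -
  have "(\<lambda>s. traj (dim_col A) X s $ j) = Rep_smooth_fun (X j)" if "j < dim_col A" for j
    using that by (simp add: traj_def fun_eq_iff)
  then show ?thesis
    by (auto simp: mat_diff_def mat_act_def Rep_sum Rep_poly_act intro!: eq_vecI sum.cong)
qed

lemma smooth_fun_eq_0_iff: "f = 0 \<longleftrightarrow> (\<forall>t. Rep_smooth_fun f t = 0)"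
  by (simp add: Rep_smooth_fun_inject[symmetric] fun_eq_iff zero_smooth_fun.rep_eq)

lemma traj_in_behavior_iff:
  "traj (dim_col A) X \<in> behavior A \<longleftrightarrow> (\<forall>i<dim_row A. mat_act A X i = 0)"
  by (auto simp: behavior_def smooth_traj_eq_range mat_diff_traj smooth_fun_eq_0_iff vec_eq_iff)

lemma traj_in_full_plant_iff:
  assumes "dim_row M = dim_row R"
  shows "(traj (dim_col R) W, traj (dim_col M) Y) \<in> full_plant R M \<longleftrightarrow>
    (\<forall>i<dim_row R. mat_act R W i + mat_act M Y i = 0)"
  using assms
  by (auto simp: full_plant_def smooth_traj_eq_range mat_diff_traj smooth_fun_eq_0_iff vec_eq_iff
      plus_smooth_fun.rep_eq)

text \<open>
  By linearity, which \<open>c\<close> is compatible with a given \<open>w\<close> is determined up to \<open>ker M\<close>, and which \<open>w\<close> with a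
  given \<open>c\<close> up to \<open>ker R\<close>. So two trajectories that share one partner share all of them.
\<close>

lemma full_plant_exchange:
  assumes dims: "dim_row M = dim_row R"
    and plant: "(w', c') \<in> full_plant R M" "(w', c) \<in> full_plant R M" "(w, c) \<in> full_plant R M"
  shows "(w, c') \<in> full_plant R M"
proof -
  obtain W W' Y Y' where eqs: "w = traj (dim_col R) W" "w' = traj (dim_col R) W'"
    "c = traj (dim_col M) Y" "c' = traj (dim_col M) Y'"
    using plant by (auto simp: full_plant_def smooth_traj_eq_range)
  have "mat_act R W i + mat_act M Y' i = 0" if "i < dim_row R" for i
  proof -
    have "mat_act R W' i + mat_act M Y' i = 0" "mat_act R W' i + mat_act M Y i = 0"
      "mat_act R W i + mat_act M Y i = 0"
      using plant that unfolding eqs traj_in_full_plant_iff[OF dims] by blast+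
    then show ?thesis by (simp add: eq_neg_iff_add_eq_0[symmetric])
  qed
  then show ?thesis unfolding eqs traj_in_full_plant_iff[OF dims] by blast
qed

lemma mat_act_combination:
  "(\<Sum>l<m. u l \<star> mat_act A Y l) = (\<Sum>j<dim_col A. (\<Sum>l<m. u l * A $$ (l, j)) \<star> Y j)"
proof -
  have "(\<Sum>l<m. u l \<star> mat_act A Y l) = (\<Sum>l<m. \<Sum>j<dim_col A. (u l * A $$ (l, j)) \<star> Y j)"
    by (simp add: mat_act_def poly_act.scale_sum_right)
  also have "\<dots> = (\<Sum>j<dim_col A. (\<Sum>l<m. u l * A $$ (l, j)) \<star> Y j)"
    by (subst sum.swap) (simp add: poly_act.scale_sum_left)
  finally show ?thesis .
qed

text \<open>
  Elimination of \<open>Y'\<close>, that is, the description of \<open>ker C + ker M\<close> by equations. The solvability criterion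
  yields the conditions \<open>v M Y = 0\<close> for all \<open>(u, v)\<close> with \<open>u C + v M = 0\<close>; writing them as \<open>u C Y = 0\<close>
  shows that they are consequences of \<open>C Y = 0\<close>, which is the reason why regularity will be inherited.
\<close>

lemma solvable_modulo_kernel_iff:
  assumes C: "C \<in> carrier_mat k nc" and M: "M \<in> carrier_mat g nc"
  shows "(\<exists>Y'. (\<forall>i<k. mat_act C Y' i = 0) \<and> (\<forall>i<g. mat_act M Y' i = mat_act M Y i)) \<longleftrightarrow>
    (\<forall>u v. (\<forall>j<nc. (\<Sum>i<k. u i * C $$ (i, j)) + (\<Sum>i<g. v i * M $$ (i, j)) = 0) \<longrightarrow>
       (\<Sum>j<nc. (\<Sum>i<k. u i * C $$ (i, j)) \<star> Y j) = 0)" (is "?solvable \<longleftrightarrow> ?ann")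
proof -
  \<comment> \<open>The two systems stacked: first the \<open>k\<close> equations of \<open>C\<close>, then the \<open>g\<close> equations of \<open>M\<close>.\<close>
  define A where "A l j = (if l < k then C $$ (l, j) else M $$ (l - k, j))" for l j
  define y where "y l = (if l < k then 0 else mat_act M Y (l - k))" for l
  have split_all: "(\<forall>l\<in>{..<k + g}. P l) \<longleftrightarrow> (\<forall>i<k. P i) \<and> (\<forall>i<g. P (k + i))" for P
    by (auto, metis add_diff_inverse_nat add_less_cancel_left)
  have "?solvable \<longleftrightarrow> (\<exists>Y'. \<forall>l\<in>{..<k + g}. (\<Sum>j<nc. A l j \<star> Y' j) = y l)"
    using C M unfolding split_all by (simp add: A_def y_def mat_act_def)
  also have "\<dots> \<longleftrightarrow> (\<forall>w. (\<forall>j<nc. (\<Sum>l<k + g. w l * A l j) = 0) \<longrightarrow> (\<Sum>l<k + g. w l \<star> y l) = 0)"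
    by (rule poly_act.solvable_iff_annihilators) simp
  also have "\<dots> \<longleftrightarrow> (\<forall>w. (\<forall>j<nc. (\<Sum>i<k. w i * C $$ (i, j)) + (\<Sum>i<g. w (k + i) * M $$ (i, j)) = 0) \<longrightarrow>
      (\<Sum>i<g. w (k + i) \<star> mat_act M Y i) = 0)"
    by (simp add: sum_lessThan_add A_def y_def)
  also have "\<dots> \<longleftrightarrow> (\<forall>u v. (\<forall>j<nc. (\<Sum>i<k. u i * C $$ (i, j)) + (\<Sum>i<g. v i * M $$ (i, j)) = 0) \<longrightarrow>
      (\<Sum>i<g. v i \<star> mat_act M Y i) = 0)" (is "?L \<longleftrightarrow> ?R")
  proof
    assume L: ?L
    show ?R
    proof (intro allI impI)
      fix u v
      assume "\<forall>j<nc. (\<Sum>i<k. u i * C $$ (i, j)) + (\<Sum>i<g. v i * M $$ (i, j)) = 0"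
      then show "(\<Sum>i<g. v i \<star> mat_act M Y i) = 0"
        using L[rule_format, of "\<lambda>l. if l < k then u l else v (l - k)"] by simp
    qed
  next
    assume R: ?R
    show ?L
    proof (intro allI impI)
      fix w
      assume "\<forall>j<nc. (\<Sum>i<k. w i * C $$ (i, j)) + (\<Sum>i<g. w (k + i) * M $$ (i, j)) = 0"
      then show "(\<Sum>i<g. w (k + i) \<star> mat_act M Y i) = 0"
        using R[rule_format, of w "\<lambda>i. w (k + i)"] by blast
    qed
  qed
  also have "\<dots> \<longleftrightarrow> ?ann"
  proof -
    have "(\<Sum>i<g. v i \<star> mat_act M Y i) = - (\<Sum>j<nc. (\<Sum>i<k. u i * C $$ (i, j)) \<star> Y j)"
      if ann: "\<forall>j<nc. (\<Sum>i<k. u i * C $$ (i, j)) + (\<Sum>i<g. v i * M $$ (i, j)) = 0" for u v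
    proof -
      have "(\<Sum>i<g. v i * M $$ (i, j)) = - (\<Sum>i<k. u i * C $$ (i, j))" if "j < nc" for j
        using ann that by (simp add: eq_neg_iff_add_eq_0 add.commute)
      then show ?thesis
        using M by (simp add: mat_act_combination sum_negf)
    qed
    then have "(\<Sum>i<g. v i \<star> mat_act M Y i) = 0 \<longleftrightarrow> (\<Sum>j<nc. (\<Sum>i<k. u i * C $$ (i, j)) \<star> Y j) = 0"
      if "\<forall>j<nc. (\<Sum>i<k. u i * C $$ (i, j)) + (\<Sum>i<g. v i * M $$ (i, j)) = 0" for u v
      using that by simp
    then show ?thesis by (intro iff_allI imp_cong refl)
  qed
  finally show ?thesis .
qed

text \<open>
  The equations of \<open>ker C + ker M\<close> found above are infinitely many, but their rows form a submodule;
  the rows of \<open>C'\<close> are a basis of it. Because it is a basis, \<open>C'\<close> has full row rank, and because the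
  submodule consists of combinations of the rows of \<open>C\<close>, so does \<open>C'\<close>.
\<close>

lemma kernel_representation_of_sum:
  assumes C: "C \<in> carrier_mat k nc" and M: "M \<in> carrier_mat g nc"
  obtains k' C' L where "C' \<in> carrier_mat k' nc" and "prank C' = k'"
    and "\<And>i j. i < k' \<Longrightarrow> j < nc \<Longrightarrow> C' $$ (i, j) = (\<Sum>l<k. L i l * C $$ (l, j))"
    and "\<And>Y. (\<forall>i<k'. mat_act C' Y i = 0) \<longleftrightarrow>
      (\<exists>Y'. (\<forall>i<k. mat_act C Y' i = 0) \<and> (\<forall>i<g. mat_act M Y' i = mat_act M Y i))"
proof -
  define row where "row u j = (if j < nc then \<Sum>i<k. u i * C $$ (i, j) else 0)" for u j
  define U where "U = {u. \<exists>v. \<forall>j<nc. row u j + (\<Sum>i<g. v i * M $$ (i, j)) = 0}"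
  have row_add: "row (\<lambda>i. u i + u' i) j = row u j + row u' j" for u u' j
    by (simp add: row_def distrib_right sum.distrib)
  have row_scale: "row (\<lambda>i. c * u i) j = c * row u j" for c u j
    by (simp add: row_def mult.assoc sum_distrib_left)
  have "(\<lambda>_. 0) \<in> U" unfolding U_def row_def by (auto intro!: exI[of _ "\<lambda>_. 0"])
  have "\<exists>k' B. row_basis (row ` U) k' B"
  proof (rule submodule_has_row_basis)
    show "row ` U \<noteq> {}" using \<open>(\<lambda>_. 0) \<in> U\<close> by blast
    show "(\<lambda>j. x j + y j) \<in> row ` U" if "x \<in> row ` U" "y \<in> row ` U" for x y
    proof -
      from that obtain u u' v v' where xy: "x = row u" "y = row u'"
        and "\<forall>j<nc. row u j + (\<Sum>i<g. v i * M $$ (i, j)) = 0"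
        and "\<forall>j<nc. row u' j + (\<Sum>i<g. v' i * M $$ (i, j)) = 0"
        by (auto simp: U_def)
      then have "\<forall>j<nc. row (\<lambda>i. u i + u' i) j + (\<Sum>i<g. (v i + v' i) * M $$ (i, j)) = 0"
        by (simp add: row_add distrib_right sum.distrib add.assoc) (metis (no_types, lifting) add.assoc add.commute add_0)
      then have "(\<lambda>i. u i + u' i) \<in> U" unfolding U_def by (intro CollectI exI)
      moreover have "(\<lambda>j. x j + y j) = row (\<lambda>i. u i + u' i)" by (simp add: xy row_add fun_eq_iff)
      ultimately show ?thesis by blast
    qed
    show "(\<lambda>j. c * x j) \<in> row ` U" if "x \<in> row ` U" for c x
    proof -
      from that obtain u v where x: "x = row u"
        and "\<forall>j<nc. row u j + (\<Sum>i<g. v i * M $$ (i, j)) = 0"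
        by (auto simp: U_def)
      then have "\<forall>j<nc. row (\<lambda>i. c * u i) j + (\<Sum>i<g. (c * v i) * M $$ (i, j)) = 0"
        by (simp add: row_scale mult.assoc sum_distrib_left[symmetric] distrib_left[symmetric])
      then have "(\<lambda>i. c * u i) \<in> U" unfolding U_def by (intro CollectI exI)
      moreover have "(\<lambda>j. c * x j) = row (\<lambda>i. c * u i)" by (simp add: x row_scale fun_eq_iff)
      ultimately show ?thesis by blast
    qed
    show "x j = 0" if "x \<in> row ` U" "j \<ge> nc" for x j
      using that by (auto simp: row_def)
  qed
  then obtain k' B where B: "row_basis (row ` U) k' B" by (elim exE)
  have "\<forall>i<k'. \<exists>u. u \<in> U \<and> B i = row u" using row_basis_in[OF B] by blast
  then obtain L where L: "\<And>i. i < k' \<Longrightarrow> L i \<in> U \<and> B i = row (L i)" by metis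
  define C' where "C' = mat k' nc (\<lambda>(i, j). B i j)"
  have C': "C' \<in> carrier_mat k' nc" by (simp add: C'_def)
  have "prank C' = k'"
  proof (rule full_row_prank_iff[OF C', THEN iffD2], rule allI, rule impI)
    fix v assume v: "\<forall>j<nc. (\<Sum>i<k'. v i * C' $$ (i, j)) = 0"
    have zero: "(\<Sum>i<k'. v i * B i j) = 0" for j
    proof (cases "j < nc")
      case True
      with v[rule_format, OF True] show ?thesis by (simp add: C'_def)
    next
      case False
      have "B i j = 0" if "i < k'" for i
        using L[OF that] False by (simp add: row_def)
      then show ?thesis by simp
    qed
    show "\<forall>i<k'. v i = 0"
      by (intro allI impI row_basis_independent[OF B, of v] zero)
  qed
  moreover have "C' $$ (i, j) = (\<Sum>l<k. L i l * C $$ (l, j))" if "i < k'" "j < nc" for i j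
    using that L[of i] by (simp add: C'_def row_def)
  moreover have "(\<forall>i<k'. mat_act C' Y i = 0) \<longleftrightarrow>
      (\<exists>Y'. (\<forall>i<k. mat_act C Y' i = 0) \<and> (\<forall>i<g. mat_act M Y' i = mat_act M Y i))" for Y
  proof -
    have "(\<exists>Y'. (\<forall>i<k. mat_act C Y' i = 0) \<and> (\<forall>i<g. mat_act M Y' i = mat_act M Y i)) \<longleftrightarrow>
        (\<forall>u\<in>U. (\<Sum>j<nc. row u j \<star> Y j) = 0)"
      unfolding solvable_modulo_kernel_iff[OF C M] by (auto simp: U_def row_def)
    also have "\<dots> \<longleftrightarrow> (\<forall>i<k'. (\<Sum>j<nc. B i j \<star> Y j) = 0)"
    proof
      assume "\<forall>u\<in>U. (\<Sum>j<nc. row u j \<star> Y j) = 0"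
      then show "\<forall>i<k'. (\<Sum>j<nc. B i j \<star> Y j) = 0" using L by simp
    next
      assume zero: "\<forall>i<k'. (\<Sum>j<nc. B i j \<star> Y j) = 0"
      show "\<forall>u\<in>U. (\<Sum>j<nc. row u j \<star> Y j) = 0"
      proof
        fix u assume "u \<in> U"
        then have "row u \<in> row ` U" by (rule imageI)
        from row_basis_generates[OF B this]
        obtain a where a: "\<And>j. row u j = (\<Sum>i<k'. a i * B i j)" by blast
        have "(\<Sum>j<nc. row u j \<star> Y j) = (\<Sum>i<k'. a i \<star> (\<Sum>j<nc. B i j \<star> Y j))"
          by (simp add: a poly_act.scale_sum_left poly_act.scale_sum_right) (rule sum.swap)
        with zero show "(\<Sum>j<nc. row u j \<star> Y j) = 0" by simp
      qed
    qed
    also have "\<dots> \<longleftrightarrow> (\<forall>i<k'. mat_act C' Y i = 0)" by (simp add: mat_act_def C'_def)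
    finally show ?thesis by blast
  qed
  ultimately show ?thesis by (rule that[OF C'])
qed

text \<open>
  \<open>K + ker M\<close> is again a regular controller: a relation \<open>u M + v C' = 0\<close> with \<open>u R = 0\<close> is a relation
  \<open>u M + (v L) C = 0\<close>, so \<open>v L = 0\<close> by regularity of \<open>C\<close>, hence \<open>v C' = v L C = 0\<close>, and \<open>v = 0\<close> by full
  row rank of \<open>C'\<close>.
\<close>

lemma regular_controller_enlarge:
  assumes R: "R \<in> carrier_mat g nw" and M: "M \<in> carrier_mat g nc"
    and "regular_controller R M K"
  obtains K' where "regular_controller R M K'"
    and "\<And>Y. traj nc Y \<in> K' \<longleftrightarrow> (\<exists>Y'. traj nc Y' \<in> K \<and> (\<forall>i<g. mat_act M Y' i = mat_act M Y i))"
proof -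
  obtain C where dim_C: "dim_col C = nc" and full: "prank C = dim_row C" and K: "K = behavior C"
    and regular: "prank (four_block_mat R M (0\<^sub>m (dim_row C) nw) C) =
        prank (four_block_mat R M (0\<^sub>m 0 nw) (0\<^sub>m 0 nc)) + prank C"
    using assms(3) R M by (auto simp: regular_controller_def)
  define k where "k = dim_row C"
  have C: "C \<in> carrier_mat k nc" using dim_C by (intro carrier_matI) (simp_all add: k_def)
  obtain k' C' L where C': "C' \<in> carrier_mat k' nc" and full': "prank C' = k'"
    and L: "\<And>i j. i < k' \<Longrightarrow> j < nc \<Longrightarrow> C' $$ (i, j) = (\<Sum>l<k. L i l * C $$ (l, j))"
    and sol: "\<And>Y. (\<forall>i<k'. mat_act C' Y i = 0) \<longleftrightarrow>
      (\<exists>Y'. (\<forall>i<k. mat_act C Y' i = 0) \<and> (\<forall>i<g. mat_act M Y' i = mat_act M Y i))"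
    by (rule kernel_representation_of_sum[OF C M]) blast
  have "prank (four_block_mat R M (0\<^sub>m k' nw) C') =
      prank (four_block_mat R M (0\<^sub>m 0 nw) (0\<^sub>m 0 nc)) + k'"
  proof (rule regular_rank_iff[OF R M C', THEN iffD2], intro allI impI)
    fix u v i
    assume u: "\<forall>j<nw. (\<Sum>l<g. u l * R $$ (l, j)) = 0"
      and uv: "\<forall>j<nc. (\<Sum>l<g. u l * M $$ (l, j)) + (\<Sum>i<k'. v i * C' $$ (i, j)) = 0" and "i < k'"
    define a where "a l = (\<Sum>i<k'. v i * L i l)" for l
    have vC': "(\<Sum>i<k'. v i * C' $$ (i, j)) = (\<Sum>l<k. a l * C $$ (l, j))" if "j < nc" for j
    proof -
      have "(\<Sum>i<k'. v i * C' $$ (i, j)) = (\<Sum>i<k'. \<Sum>l<k. v i * L i l * C $$ (l, j))"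
        using that by (simp add: L sum_distrib_left mult.assoc)
      also have "\<dots> = (\<Sum>l<k. a l * C $$ (l, j))"
        by (subst sum.swap) (simp add: a_def sum_distrib_right)
      finally show ?thesis .
    qed
    have "\<forall>j<nc. (\<Sum>l<g. u l * M $$ (l, j)) + (\<Sum>l<k. a l * C $$ (l, j)) = 0"
      using uv vC' by simp
    moreover have "prank (four_block_mat R M (0\<^sub>m k nw) C) =
        prank (four_block_mat R M (0\<^sub>m 0 nw) (0\<^sub>m 0 nc)) + k"
      using regular full by (simp add: k_def)
    ultimately have "\<forall>l<k. a l = 0"
      using regular_rank_iff[OF R M C, THEN iffD1] u by blast
    then have "\<forall>j<nc. (\<Sum>i<k'. v i * C' $$ (i, j)) = 0" using vC' by simp
    with full_row_prank_iff[OF C'] full' \<open>i < k'\<close> show "v i = 0" by blast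
  qed
  then have "regular_controller R M (behavior C')"
    unfolding regular_controller_def using C' R M full' by (intro exI[of _ C']) auto
  moreover have "traj nc Y \<in> behavior C' \<longleftrightarrow>
      (\<exists>Y'. traj nc Y' \<in> K \<and> (\<forall>i<g. mat_act M Y' i = mat_act M Y i))" for Y
    using traj_in_behavior_iff[of C'] traj_in_behavior_iff[of C] C C' sol[of Y]
    by (simp add: K)
  ultimately show ?thesis by (rule that)
qed

section \<open>Controllers equivalent to the canonical controller\<close>

text \<open>
  Only trajectories in \<open>\<P>\<^sub>c\<close> matter for the controlled behavior, so every controller that agrees there
  with the canonical one implements the same specification. The canonical controller implements \<open>\<S>\<close>
  itself: a \<open>w\<close> that shares a control trajectory with some \<open>w' \<in> \<S>\<close> shares all of them, in particular
  one that an implementing controller admits.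
\<close>

lemma canonical_equivalent_implements:
  assumes dims: "dim_row M = dim_row R" and "implementable R M S"
    and K: "K \<subseteq> smooth_traj (dim_col M)"
    and canonical: "K \<inter> control_manifest R M = canonical_controller R M S \<inter> control_manifest R M"
  shows "implements R M K S"
proof -
  obtain K0 where K0: "controlled_behavior R M K0 = S"
    using assms(2) by (auto simp: implementable_def implements_def)
  have "w \<in> S" if "w \<in> controlled_behavior R M K" for w
  proof -
    from that obtain c where w: "w \<in> smooth_traj (dim_col R)" and c: "c \<in> K" "(w, c) \<in> full_plant R M"
      by (auto simp: controlled_behavior_def)
    then have "c \<in> K \<inter> control_manifest R M" using K by (auto simp: control_manifest_def)
    with canonical obtain w' where w': "w' \<in> S" "(w', c) \<in> full_plant R M"
      by (auto simp: canonical_controller_def)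
    then obtain c0 where "c0 \<in> K0" "(w', c0) \<in> full_plant R M"
      using K0 by (auto simp: controlled_behavior_def)
    moreover from this have "(w, c0) \<in> full_plant R M"
      using full_plant_exchange[OF dims _ w'(2) c(2)] by blast
    ultimately show "w \<in> S" using K0 w by (auto simp: controlled_behavior_def)
  qed
  moreover have "w \<in> controlled_behavior R M K" if "w \<in> S" for w
  proof -
    from that K0 obtain c where w: "w \<in> smooth_traj (dim_col R)" "(w, c) \<in> full_plant R M"
      by (auto simp: controlled_behavior_def)
    then have "c \<in> canonical_controller R M S \<inter> control_manifest R M"
      using \<open>w \<in> S\<close> by (auto simp: canonical_controller_def control_manifest_def full_plant_def)
    with canonical w show ?thesis by (auto simp: controlled_behavior_def)
  qed
  ultimately show ?thesis by (auto simp: implements_def)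
qed

theorem theorem8:
  fixes R M S :: "real poly mat" and g nw nc ns :: nat
  assumes "R \<in> carrier_mat g nw" and "M \<in> carrier_mat g nc"
    and "S \<in> carrier_mat ns nw"
    and "implementable R M (behavior S)"
  shows "regular_canonical_controllers R M (behavior S) \<noteq> {} \<longleftrightarrow>
         regularly_implementable R M (behavior S)"
proof -
  have dims: "dim_row M = dim_row R" using assms by simp
  show ?thesis
  proof
    assume "regular_canonical_controllers R M (behavior S) \<noteq> {}"
    then obtain K where K: "regular_controller R M K"
      and canonical: "K \<inter> control_manifest R M = canonical_controller R M (behavior S) \<inter> control_manifest R M"
      by (auto simp: regular_canonical_controllers_def)
    from K have "K \<subseteq> smooth_traj (dim_col M)"
      by (auto simp: regular_controller_def behavior_def)
    with canonical_equivalent_implements[OF dims assms(4)] canonical K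
    show "regularly_implementable R M (behavior S)"
      by (auto simp: regularly_implementable_def)
  next
    assume "regularly_implementable R M (behavior S)"
    then obtain K where K: "regular_controller R M K" "controlled_behavior R M K = behavior S"
      by (auto simp: regularly_implementable_def implements_def)
    obtain K' where K': "regular_controller R M K'"
      and mod_ker: "\<And>Y. traj nc Y \<in> K' \<longleftrightarrow>
        (\<exists>Y'. traj nc Y' \<in> K \<and> (\<forall>i<g. mat_act M Y' i = mat_act M Y i))"
      by (rule regular_controller_enlarge[OF assms(1,2) K(1)]) blast
    have K_smooth: "K \<subseteq> range (traj nc)" "K' \<subseteq> range (traj nc)"
      using K(1) K' assms(2)
      by (auto simp: regular_controller_def behavior_def smooth_traj_eq_range)
    have plant: "(traj nw W, traj nc Y) \<in> full_plant R M \<longleftrightarrow> (\<forall>i<g. mat_act R W i + mat_act M Y i = 0)" for W Y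
      using traj_in_full_plant_iff[OF dims, of W Y] assms by simp
    have "K' \<inter> control_manifest R M = canonical_controller R M (behavior S) \<inter> control_manifest R M"
    proof (intro equalityI subsetI IntI)
      fix c assume c: "c \<in> K' \<inter> control_manifest R M"
      then obtain w Y where w: "w \<in> smooth_traj (dim_col R)" "(w, c) \<in> full_plant R M" and Y: "c = traj nc Y"
        using K_smooth by (auto simp: control_manifest_def)
      obtain W where W: "w = traj nw W" using w(1) assms(1) by (auto simp: smooth_traj_eq_range)
      obtain Y' where Y': "traj nc Y' \<in> K" "\<forall>i<g. mat_act M Y' i = mat_act M Y i"
        using c mod_ker[of Y] Y by blast
      have "(w, traj nc Y') \<in> full_plant R M" using w(2) Y'(2) unfolding W Y plant by simp
      with Y'(1) w(1) K(2) have "w \<in> behavior S" by (auto simp: controlled_behavior_def)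
      with w(2) c show "c \<in> canonical_controller R M (behavior S)"
        by (auto simp: canonical_controller_def control_manifest_def)
    next
      fix c assume "c \<in> canonical_controller R M (behavior S) \<inter> control_manifest R M"
      then obtain w where w: "w \<in> behavior S" "(w, c) \<in> full_plant R M"
        by (auto simp: canonical_controller_def)
      with K(2) obtain c' where c': "c' \<in> K" "(w, c') \<in> full_plant R M"
        by (auto simp: controlled_behavior_def)
      obtain W Y Y' where eqs: "w = traj nw W" "c = traj nc Y" "c' = traj nc Y'"
        using w(2) c'(2) assms(1,2) by (auto simp: full_plant_def smooth_traj_eq_range)
      have "mat_act M Y' i = mat_act M Y i" if "i < g" for i
      proof -
        have "mat_act R W i + mat_act M Y i = 0" "mat_act R W i + mat_act M Y' i = 0"
          using w(2) c'(2) that unfolding eqs plant by blast+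
        then show ?thesis by (metis add_left_imp_eq)
      qed
      with c'(1) show "c \<in> K'" using mod_ker[of Y] unfolding eqs by blast
    qed auto
    with K' show "regular_canonical_controllers R M (behavior S) \<noteq> {}"
      by (auto simp: regular_canonical_controllers_def)
  qed
qed

end
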